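(* Let $\mathfrak{g}=\bigoplus_{i=0}^\infty\mathbb{C}e_i$ be the complex Lie algebra with bracket $[e_0,e_k]=e_{k-1}$ for $k\ge2$, $[e_j,e_0]=-e_{j-1}$ for $j\ge2$, and $[e_j,e_k]=0$ otherwise. Let $e_i^*\in\mathfrak{g}^*$ be defined by $e_i^*(e_j)=\delta_{ij}$. Then: (a) For any $a\in\mathbb{C}[\partial]$ that is not a nonzero constant ($a=0$ is allowed), $$J_a:=\big(a(\partial)\mathbb{C}[\partial]\otimes e_0\big)\oplus\Big(\bigoplus_{i=1}^\infty\mathbb{C}[\partial]\otimes e_i\Big)$$ is an ideal of $\operatorname{Cur}(\mathfrak{g})$, and these are all the nontrivial (i.e. different from $0$ and $\operatorname{Cur}(\mathfrak{g})$) ideals of cofinite rank in $\operatorname{Cur}(\mathfrak{g})$. (b) $0\ne\mathbb{C}[\partial]e_0^*=\operatorname{Loc}((\operatorname{Cur}(\mathfrak{g}))^0)$, where $e_0^*$ is regarded as the element $\Theta(1\otimes e_0^* )$ of $(\operatorname{Cur}(\mathfrak{g}))^{*c}$. (c) $\bigoplus_{i=0}^\infty\mathbb{C}e_i^*$ is a good subspace of $\mathfrak{g}^*$, with coproduct $\delta(e_0^* )=0$ and $\delta(e_i^* )=e_0^*\otimes e_{i+1}^*-e_{i+1}^*\otimes e_0^*$ for all $i\ge1$. (d) $\Theta\big(\operatorname{Cur}(\bigoplus_{i=0}^\infty\mathbb{C}e_i^* )\big)\subseteq(\operatorname{Cur}(\mathfrak{g}))^0$. (e) $0\ne\operatorn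ame{Loc}((\operatorname{Cur}(\mathfrak{g}))^0)\subsetneqq(\operatorname{Cur}(\mathfrak{g}))^0$.
   Context: A Lie conformal algebra $L$ is a $\mathbb{C}[\partial]$-module with a $\mathbb{C}$-linear map $L\otimes L\to\mathbb{C}[\lambda]\otimes L$, $a\otimes b\mapsto[a_\lambda b]$, satisfying $[\partial a_\lambda b]=-\lambda[a_\lambda b]$, $[a_\lambda\partial b]=(\lambda+\partial)[a_\lambda b]$, $[a_\lambda b]=-[b_{-\lambda-\partial}\,a]$, and $[a_\lambda[b_\mu c]]=[[a_\lambda b]_{\lambda+\mu}c]+[b_\mu[a_\lambda c]]$. An ideal is a $\mathbb{C}[\partial]$-submodule $I$ with $[a_\lambda b]\in\mathbb{C}[\lambda]\otimes I$ for all $a\in L$, $b\in I$. A $\mathbb{C}[\partial]$-module has finite rank if it is of the form $\bigoplus_{i=1}^n\mathbb{C}[\partial]a_i\oplus T$ with the first summand free and $T$ the torsion submodule. An ideal $I$ has cofinite rank if $L/I$ has finite rank. The conformal dual of a $\mathbb{C}[\partial]$-module $U$ is $U^{*c}=\{f:U\to\mathbb{C}[\lambda]\mid f\ \mathbb{C}\text{-linear},\ f_\lambda(\partial u)=\lambda f_\lambda(u)\}$, with $\mathbb{C}[\partial]$-action $(\partial f)_\lambda=-\lambda f_\lambda$. Tensor products are over $\mathbb{C}$, with $\partial(u\otimes v)=\partial u\otimes v+u\otimes\partial v$. A differential Lie coalgebra $(C,\delta)$ is a $\mathbb{C}[\partial]$-module $C$ with a $\mathbb{C}[\partial]$-homomorphism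 $\delta:C\to C\otimes C$ such that $\tau\delta=-\delta$ and $(I\otimes\delta)\delta-(\tau\otimes I)(I\otimes\delta)\delta=(\delta\otimes I)\delta$, where $\tau(a\otimes b)=b\otimes a$. A subcoalgebra is a $\mathbb{C}[\partial]$-submodule $B$ with $\delta(B)\subseteq B\otimes B$. For a differential Lie coalgebra $M$, $\operatorname{Loc}(M)$ is the sum of all finite-rank differential Lie subcoalgebras of $M$. A $\mathbb{C}[\partial]$-submodule $V\subseteq L^{*c}$ is good if for each $f\in V$ there is $\sum f_{(1)}\otimes f_{(2)}\in V\otimes V$ with $f_\lambda([a_\mu b])=\sum(f_{(1)})_{-\mu}(a)\,(f_{(2)})_{\lambda+\mu}(b)$ for all $a,b\in L$; this element is unique and is denoted $\delta_V(f)$, and $(V,\delta_V)$ is a differential Lie coalgebra. $L^0$ is the sum of all good submodules of $L^{*c}$; it is the largest good submodule, and is a differential Lie coalgebra with $\delta_{L^0}$. Classical version: for a complex Lie algebra $\mathfrak{g}$, a subspace $V\subseteq\mathfrak{g}^*$ is good if for each $\phi\in V$ there is a (necessarily unique) $\delta(\phi)=\sum\phi_{(1)}\otimes\phi_{(2)}\in V\otimes V$ with $\phi([x,y])=\sum\phi_{(1)}(x)\phi_{(2)}(y)$ for all $x,y\in\mathfrak{g}$; $\delta$ is called its coproduct. For a complex vector space $V$, $\operatorname{Cur}(V)=\mathbb{C}[\partial]\otimes V$. For a Lie algebra $\mathfrak{g}$, $\operatorname{Cur}(\mathfrak{g})$ is a Lie conformal algebra with $[f\otimes a\,{}_\lambda\,g\otimes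 b]=f(-\lambda)g(\lambda+\partial)\otimes[a,b]$. The injective $\mathbb{C}[\partial]$-homomorphism $\Theta:\operatorname{Cur}(V^* )\to(\operatorname{Cur}(V))^{*c}$ is given by $\Theta\big(\sum_i\partial^{k_i}\otimes\phi_i\big)_\lambda\big(\sum_jp_j(\partial)\otimes v_j\big)=\sum_{i,j}(-\lambda)^{k_i}p_j(\lambda)\phi_i(v_j)$. *)

theory Defs
  imports
    Complex_Main
    "HOL-Library.Function_Algebras"
    "HOL-Library.Poly_Mapping"
    "HOL-Computational_Algebra.Polynomial"
begin

section \<open>Complex vector spaces\<close>

class complex_vector = ab_group_add +
  fixes scaleC :: "complex \<Rightarrow> 'a \<Rightarrow> 'a" (infixr "*\<^sub>C" 75)
  assumes scaleC_add_right: "c *\<^sub>C (x + y) = c *\<^sub>C x + c *\<^sub>C y"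
    and scaleC_add_left: "(c + d) *\<^sub>C x = c *\<^sub>C x + d *\<^sub>C x"
    and scaleC_scaleC: "c *\<^sub>C d *\<^sub>C x = (c * d) *\<^sub>C x"
    and scaleC_one: "1 *\<^sub>C x = x"

interpretation cv: vector_space "scaleC :: complex \<Rightarrow> 'a \<Rightarrow> 'a::complex_vector"
  by unfold_locales (simp_all add: scaleC_add_right scaleC_add_left scaleC_scaleC scaleC_one)

abbreviation clinear :: "('a::complex_vector \<Rightarrow> 'b::complex_vector) \<Rightarrow> bool" where
  "clinear \<equiv> Vector_Spaces.linear scaleC scaleC"

definition cbilinear ::
    "('a::complex_vector \<Rightarrow> 'b::complex_vector \<Rightarrow> 'c::complex_vector) \<Rightarrow> bool" where
  "cbilinear \<beta> \<longleftrightarrow> (\<forall>a. clinear (\<beta> a)) \<and> (\<forall>b. clinear (\<lambda>a. \<beta> a b))"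

lemma clinearI:
  assumes "\<And>x y. f (x + y) = f x + f y" "\<And>c x. f (c *\<^sub>C x) = c *\<^sub>C f x"
  shows "clinear f"
  using assms by (simp add: Vector_Spaces.linear_iff cv.vector_space_axioms)

lemma clinear_add: "clinear f \<Longrightarrow> f (x + y) = f x + f y"
  and clinear_scale: "clinear f \<Longrightarrow> f (c *\<^sub>C x) = c *\<^sub>C f x"
  by (simp_all add: Vector_Spaces.linear_iff)

lemma clinear_0: "clinear f \<Longrightarrow> f 0 = 0"
  using clinear_scale[of f 0 0] by simp

instantiation complex :: complex_vector
begin
definition "scaleC_complex = ((*) :: complex \<Rightarrow> complex \<Rightarrow> complex)"
instance by standard (simp_all add: scaleC_complex_def algebra_simps)
end

instantiation "fun" :: (type, complex_vector) complex_vector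
begin
definition "scaleC_fun c f = (\<lambda>x. c *\<^sub>C f x)"
instance
  by standard
    (simp_all add: scaleC_fun_def fun_eq_iff scaleC_add_right scaleC_add_left scaleC_scaleC scaleC_one)
end

instantiation poly :: (complex_vector) complex_vector
begin
definition "scaleC_poly c p = map_poly ((*\<^sub>C) c) p"
instance
  by standard
    (simp_all add: scaleC_poly_def poly_eq_iff coeff_map_poly
      scaleC_add_right scaleC_add_left scaleC_scaleC scaleC_one)
end

lemma coeff_scaleC [simp]: "coeff (c *\<^sub>C p) n = c *\<^sub>C coeff p n"
  by (simp add: scaleC_poly_def coeff_map_poly)

lemma scaleC_complex_poly: "c *\<^sub>C p = smult c p" for p :: "complex poly"
  by (simp add: poly_eq_iff scaleC_complex_def)

instantiation poly_mapping :: (type, complex_vector) complex_vector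
begin
lift_definition scaleC_poly_mapping ::
    "complex \<Rightarrow> ('a \<Rightarrow>\<^sub>0 'b) \<Rightarrow> ('a \<Rightarrow>\<^sub>0 'b)" is "\<lambda>c f k. c *\<^sub>C f k"
  by (rule finite_subset[rotated], assumption) auto
instance
  by standard
    (transfer; simp add: fun_eq_iff scaleC_add_right scaleC_add_left scaleC_scaleC scaleC_one)+
end

lemma lookup_scaleC [simp]: "Poly_Mapping.lookup (c *\<^sub>C f) k = c *\<^sub>C Poly_Mapping.lookup f k"
  by transfer simp


section \<open>Tensor products over the complex numbers\<close>

definition tensor_relators ::
    "(('a::complex_vector \<times> 'b::complex_vector) \<Rightarrow>\<^sub>0 complex) set" where
  "tensor_relators =
     {Poly_Mapping.single (a + a', b) 1 - Poly_Mapping.single (a, b) 1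
        - Poly_Mapping.single (a', b) 1 | a a' b. True}
   \<union> {Poly_Mapping.single (a, b + b') 1 - Poly_Mapping.single (a, b) 1
        - Poly_Mapping.single (a, b') 1 | a b b'. True}
   \<union> {Poly_Mapping.single (c *\<^sub>C a, b) 1 - Poly_Mapping.single (a, b) c | c a b. True}
   \<union> {Poly_Mapping.single (a, c *\<^sub>C b) 1 - Poly_Mapping.single (a, b) c | c a b. True}"

definition tensor_rel ::
    "('a::complex_vector \<times> 'b::complex_vector \<Rightarrow>\<^sub>0 complex) \<Rightarrow> ('a \<times> 'b \<Rightarrow>\<^sub>0 complex) \<Rightarrow> bool" where
  "tensor_rel r s \<longleftrightarrow> r - s \<in> cv.span tensor_relators"

lemma equivp_tensor_rel: "equivp tensor_rel"
proof (rule equivpI)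
  show "reflp tensor_rel"
    by (simp add: reflp_def tensor_rel_def cv.span_zero)
  show "symp tensor_rel"
    by (metis (no_types, lifting) symp_def tensor_rel_def cv.span_neg minus_diff_eq)
  show "transp tensor_rel"
    by (rule transpI) (use cv.span_add in \<open>force simp: tensor_rel_def\<close>)
qed

quotient_type (overloaded) ('a, 'b) tensor =
    "('a::complex_vector \<times> 'b::complex_vector) \<Rightarrow>\<^sub>0 complex" / tensor_rel
  by (rule equivp_tensor_rel)

instantiation tensor :: (complex_vector, complex_vector) complex_vector
begin
lift_definition zero_tensor :: "('a, 'b) tensor" is 0 .
lift_definition plus_tensor :: "('a, 'b) tensor \<Rightarrow> ('a, 'b) tensor \<Rightarrow> ('a, 'b) tensor" is "(+)"
  unfolding tensor_rel_def by (drule (1) cv.span_add) (simp add: algebra_simps)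
lift_definition minus_tensor :: "('a, 'b) tensor \<Rightarrow> ('a, 'b) tensor \<Rightarrow> ('a, 'b) tensor" is "(-)"
  unfolding tensor_rel_def by (drule (1) cv.span_diff) (simp add: algebra_simps)
lift_definition uminus_tensor :: "('a, 'b) tensor \<Rightarrow> ('a, 'b) tensor" is uminus
  unfolding tensor_rel_def by (drule cv.span_neg) simp
lift_definition scaleC_tensor :: "complex \<Rightarrow> ('a, 'b) tensor \<Rightarrow> ('a, 'b) tensor" is scaleC
  unfolding tensor_rel_def by (drule cv.span_scale) (simp add: cv.scale_right_diff_distrib)
instance
  by standard
    (transfer; simp add: tensor_rel_def cv.span_zero algebra_simps
      scaleC_add_right scaleC_add_left scaleC_scaleC scaleC_one)+
end

lift_definition pure_tensor ::
    "'a::complex_vector \<Rightarrow> 'b::complex_vector \<Rightarrow> ('a, 'b) tensor" (infixr "\<otimes>" 72)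
  is "\<lambda>a b. Poly_Mapping.single (a, b) 1" .

text \<open>Over a field the tensor product of two subspaces embeds into that of the ambient spaces, so it
  is represented as a subspace of the latter.\<close>

definition tensor_sub ::
    "'a::complex_vector set \<Rightarrow> 'b::complex_vector set \<Rightarrow> ('a, 'b) tensor set" where
  "tensor_sub A B = cv.span {a \<otimes> b | a b. a \<in> A \<and> b \<in> B}"

text \<open>The linear map on \<open>A \<otimes> B\<close> induced by a map \<open>\<beta>\<close> that is only required to be bilinear on
  \<open>A \<times> B\<close>; hence the representative has to be chosen with support in \<open>A \<times> B\<close>.\<close>

definition tensor_lift_on ::
    "'a::complex_vector set \<Rightarrow> 'b::complex_vector set \<Rightarrow> ('a \<Rightarrow> 'b \<Rightarrow> 'c::complex_vector)
      \<Rightarrow> ('a, 'b) tensor \<Rightarrow> 'c" where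
  "tensor_lift_on A B \<beta> t =
     (let r = (SOME r. Poly_Mapping.keys r \<subseteq> A \<times> B \<and> abs_tensor r = t)
      in \<Sum>(a, b)\<in>Poly_Mapping.keys r. Poly_Mapping.lookup r (a, b) *\<^sub>C \<beta> a b)"

abbreviation tensor_lift ::
    "('a::complex_vector \<Rightarrow> 'b::complex_vector \<Rightarrow> 'c::complex_vector) \<Rightarrow> ('a, 'b) tensor \<Rightarrow> 'c" where
  "tensor_lift \<equiv> tensor_lift_on UNIV UNIV"

definition tensor_swap ::
    "('a::complex_vector, 'b::complex_vector) tensor \<Rightarrow> ('b, 'a) tensor" where
  "tensor_swap = tensor_lift (\<lambda>a b. b \<otimes> a)"

definition tensor_assoc ::
    "('a::complex_vector, ('b::complex_vector, 'c::complex_vector) tensor) tensor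
      \<Rightarrow> (('a, 'b) tensor, 'c) tensor" where
  "tensor_assoc = tensor_lift (\<lambda>a. tensor_lift (\<lambda>b c. (a \<otimes> b) \<otimes> c))"

definition ext_lin ::
    "('a \<Rightarrow> 'b \<Rightarrow> 'c::complex_vector) \<Rightarrow> ('a \<times> 'b \<Rightarrow>\<^sub>0 complex) \<Rightarrow> 'c" where
  "ext_lin \<beta> r = (\<Sum>(a, b)\<in>Poly_Mapping.keys r. Poly_Mapping.lookup r (a, b) *\<^sub>C \<beta> a b)"

lemma ext_lin_superset:
  assumes "finite S" "Poly_Mapping.keys r \<subseteq> S"
  shows "ext_lin \<beta> r = (\<Sum>(a, b)\<in>S. Poly_Mapping.lookup r (a, b) *\<^sub>C \<beta> a b)"
  unfolding ext_lin_def
  by (rule sum.mono_neutral_left) (use assms in \<open>auto simp: in_keys_iff\<close>)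

lemma ext_lin_clinear: "clinear (ext_lin \<beta>)"
proof (rule clinearI)
  fix r s :: "'a \<times> 'b \<Rightarrow>\<^sub>0 complex" and c
  let ?S = "Poly_Mapping.keys r \<union> Poly_Mapping.keys s"
  have "Poly_Mapping.keys (r + s) \<subseteq> ?S" by (rule Poly_Mapping.keys_add)
  then show "ext_lin \<beta> (r + s) = ext_lin \<beta> r + ext_lin \<beta> s"
    by (simp add: ext_lin_superset[of ?S] lookup_add scaleC_add_left split_def sum.distrib)
  have "Poly_Mapping.keys (c *\<^sub>C r) \<subseteq> Poly_Mapping.keys r"
    by (auto simp: in_keys_iff)
  then show "ext_lin \<beta> (c *\<^sub>C r) = c *\<^sub>C ext_lin \<beta> r"
    by (simp add: ext_lin_superset[of "Poly_Mapping.keys r"] scaleC_complex_def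
        cv.scale_sum_right scaleC_scaleC split_def)
qed

lemma ext_lin_single [simp]: "ext_lin \<beta> (Poly_Mapping.single (a, b) c) = c *\<^sub>C \<beta> a b"
  by (cases "c = 0") (simp_all add: ext_lin_def)

lemma clinear_diff: "clinear f \<Longrightarrow> f (x - y) = f x - f y"
  using clinear_add[of f "x - y" y] by simp

lemma ext_lin_relators:
  assumes "cbilinear \<beta>" "r \<in> cv.span tensor_relators"
  shows "ext_lin \<beta> r = 0"
  using assms(2)
proof (induction rule: cv.span_induct_alt)
  case base
  show ?case by (simp add: ext_lin_def)
next
  case (step c x y)
  have l: "\<And>a. clinear (\<beta> a)" "\<And>b. clinear (\<lambda>a. \<beta> a b)"
    using assms(1) by (auto simp: cbilinear_def)
  have "ext_lin \<beta> x = 0"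
    using step(1) unfolding tensor_relators_def
    by (auto simp: clinear_diff[OF ext_lin_clinear] scaleC_one
        clinear_add[OF l(1)] clinear_add[OF l(2)] clinear_scale[OF l(1)] clinear_scale[OF l(2)])
  then show ?case
    using step by (simp add: clinear_add[OF ext_lin_clinear] clinear_scale[OF ext_lin_clinear])
qed

lemma tensor_lift_abs:
  assumes "cbilinear \<beta>"
  shows "tensor_lift \<beta> (abs_tensor r) = ext_lin \<beta> r"
proof -
  define s where "s = (SOME s. Poly_Mapping.keys s \<subseteq> (UNIV :: 'a set) \<times> (UNIV :: 'b set)
    \<and> abs_tensor s = abs_tensor r)"
  have "abs_tensor s = abs_tensor r"
    unfolding s_def by (rule someI2[where a = r]) auto
  then have "s - r \<in> cv.span tensor_relators"
    by (simp add: tensor.abs_eq_iff tensor_rel_def)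
  then have "ext_lin \<beta> s = ext_lin \<beta> r"
    using ext_lin_relators[OF assms, of "s - r"] by (simp add: clinear_diff[OF ext_lin_clinear])
  then show ?thesis
    by (simp add: tensor_lift_on_def Let_def ext_lin_def s_def)
qed

lemma tensor_lift_clinear:
  assumes "cbilinear \<beta>" shows "clinear (tensor_lift \<beta>)"
proof (rule clinearI)
  fix x y :: "('a, 'b) tensor" and c
  obtain r where [simp]: "x = abs_tensor r"
    using tensor.abs_induct[of "\<lambda>x. \<exists>r. x = abs_tensor r" x] by auto
  obtain s where [simp]: "y = abs_tensor s"
    using tensor.abs_induct[of "\<lambda>x. \<exists>r. x = abs_tensor r" y] by auto
  show "tensor_lift \<beta> (x + y) = tensor_lift \<beta> x + tensor_lift \<beta> y"
    by (simp add: plus_tensor.abs_eq tensor_lift_abs[OF assms] clinear_add[OF ext_lin_clinear])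
  show "tensor_lift \<beta> (c *\<^sub>C x) = c *\<^sub>C tensor_lift \<beta> x"
    by (simp add: scaleC_tensor.abs_eq tensor_lift_abs[OF assms] clinear_scale[OF ext_lin_clinear])
qed

lemma tensor_lift_pure:
  assumes "cbilinear \<beta>" shows "tensor_lift \<beta> (a \<otimes> b) = \<beta> a b"
  by (simp add: pure_tensor.abs_eq tensor_lift_abs[OF assms] scaleC_one)

lemma tensor_relators_mem:
  "Poly_Mapping.single (a + a', b) 1 - Poly_Mapping.single (a, b) 1 - Poly_Mapping.single (a', b) 1
     \<in> tensor_relators"
  "Poly_Mapping.single (a, b + b') 1 - Poly_Mapping.single (a, b) 1 - Poly_Mapping.single (a, b') 1
     \<in> tensor_relators"
  "Poly_Mapping.single (c *\<^sub>C a, b) 1 - Poly_Mapping.single (a, b) c \<in> tensor_relators"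
  "Poly_Mapping.single (a, c *\<^sub>C b) 1 - Poly_Mapping.single (a, b) c \<in> tensor_relators"
  unfolding tensor_relators_def by blast+

lemma pure_tensor_bilinear: "cbilinear (\<otimes>)"
  unfolding cbilinear_def
proof (intro conjI allI clinearI)
  fix a a' :: 'a and b b' :: 'b and c
  note defs = plus_tensor.abs_eq pure_tensor.abs_eq scaleC_tensor.abs_eq tensor.abs_eq_iff
    tensor_rel_def
  have sc: "c *\<^sub>C Poly_Mapping.single (a, b) 1 = Poly_Mapping.single (a, b) c"
    by (rule poly_mapping_eqI) (simp add: lookup_single when_def scaleC_complex_def)
  show "a \<otimes> (b + b') = a \<otimes> b + a \<otimes> b'"
    unfolding defs diff_diff_add[symmetric] by (rule cv.span_base[OF tensor_relators_mem(2)])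
  show "(a + a') \<otimes> b = a \<otimes> b + a' \<otimes> b"
    unfolding defs diff_diff_add[symmetric] by (rule cv.span_base[OF tensor_relators_mem(1)])
  show "a \<otimes> (c *\<^sub>C b) = c *\<^sub>C (a \<otimes> b)"
    unfolding defs sc by (rule cv.span_base[OF tensor_relators_mem(4)])
  show "(c *\<^sub>C a) \<otimes> b = c *\<^sub>C (a \<otimes> b)"
    unfolding defs sc by (rule cv.span_base[OF tensor_relators_mem(3)])
qed

lemma tensor_in_span_pure: "t \<in> cv.span {a \<otimes> b | a b. True}"
proof -
  obtain r where t: "t = abs_tensor r"
    using tensor.abs_induct[of "\<lambda>x. \<exists>r. x = abs_tensor r" t] by auto
  have "abs_tensor r \<in> cv.span {a \<otimes> b | a b. True}"
  proof (induction r rule: update_induct)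
    case const
    then show ?case by (metis cv.span_zero zero_tensor.abs_eq)
  next
    case (update f a b)
    obtain u v where a: "a = (u, v)" by (cases a)
    have "Poly_Mapping.update a b f = f + b *\<^sub>C Poly_Mapping.single (u, v) 1"
      using update(1) unfolding a
      by (intro poly_mapping_eqI)
        (auto simp add: lookup_add lookup_single lookup_update when_def scaleC_complex_def in_keys_iff)
    then have "abs_tensor (Poly_Mapping.update a b f) = abs_tensor f + b *\<^sub>C (u \<otimes> v)"
      by (simp add: plus_tensor.abs_eq scaleC_tensor.abs_eq pure_tensor.abs_eq)
    then show ?case
      using update(3) by (auto intro!: cv.span_add cv.span_scale intro: cv.span_base)
  qed
  then show ?thesis unfolding t .
qed

lemma tensor_ext:
  assumes "clinear f" "clinear g" "\<And>a b. f (a \<otimes> b) = g (a \<otimes> b)"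
  shows "f t = g t"
  using tensor_in_span_pure[of t]
proof (induction rule: cv.span_induct_alt)
  case base
  then show ?case using assms by (simp add: clinear_0)
next
  case (step c x y)
  then show ?case using assms by (auto simp: clinear_add clinear_scale)
qed

lemma clinear_compose: "clinear f \<Longrightarrow> clinear g \<Longrightarrow> clinear (\<lambda>x. f (g x))"
  by (simp add: Vector_Spaces.linear_iff)

lemma clinear_plus: "clinear f \<Longrightarrow> clinear g \<Longrightarrow> clinear (\<lambda>x. f x + g x)"
  by (rule clinearI) (simp_all add: clinear_add clinear_scale scaleC_add_right)

lemma clinear_uminus: "clinear f \<Longrightarrow> clinear (\<lambda>x. - f x)"
  by (rule clinearI) (simp_all add: clinear_add clinear_scale)

lemma clinear_mult: "clinear f \<Longrightarrow> clinear (\<lambda>x. c *\<^sub>C f x)"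
  by (rule clinearI) (simp_all add: clinear_add clinear_scale scaleC_add_right scaleC_scaleC mult.commute)

lemma clinear_id: "clinear (\<lambda>x. x)"
  by (rule clinearI) simp_all

lemma cbilinearD: "cbilinear \<beta> \<Longrightarrow> clinear (\<beta> a)" "cbilinear \<beta> \<Longrightarrow> clinear (\<lambda>a. \<beta> a b)"
  by (auto simp: cbilinear_def)

lemmas pure_tensor_simps =
  clinear_add[OF cbilinearD(1)[OF pure_tensor_bilinear]]
  clinear_add[OF cbilinearD(2)[OF pure_tensor_bilinear]]
  clinear_scale[OF cbilinearD(1)[OF pure_tensor_bilinear]]
  clinear_scale[OF cbilinearD(2)[OF pure_tensor_bilinear]]
  clinear_0[OF cbilinearD(1)[OF pure_tensor_bilinear]]
  clinear_0[OF cbilinearD(2)[OF pure_tensor_bilinear]]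

text \<open>For fixed \<open>t\<close> the value is linear in \<open>\<beta>\<close>, since the representative is chosen independently
  of \<open>\<beta>\<close>.\<close>

lemma tensor_lift_on_add:
  "tensor_lift_on A B (\<lambda>a b. \<beta> a b + \<gamma> a b) t = tensor_lift_on A B \<beta> t + tensor_lift_on A B \<gamma> t"
  by (simp add: tensor_lift_on_def Let_def split_def scaleC_add_right sum.distrib)

lemma tensor_lift_on_scale:
  "tensor_lift_on A B (\<lambda>a b. c *\<^sub>C \<beta> a b) t = c *\<^sub>C tensor_lift_on A B \<beta> t"
  by (simp add: tensor_lift_on_def Let_def split_def cv.scale_sum_right scaleC_scaleC mult.commute)


section \<open>Modules over the polynomial ring in the derivation\<close>

text \<open>The polynomial ring \<open>\<complex>[\<partial>]\<close> is \<^typ>\<open>complex poly\<close>, with \<open>\<partial> = [:0, 1:]\<close>.\<close>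

locale dmodule = module smul
  for smul :: "complex poly \<Rightarrow> 'a::complex_vector \<Rightarrow> 'a" +
  assumes smul_const: "smul [:c:] x = c *\<^sub>C x"
begin

abbreviation der :: "'a \<Rightarrow> 'a" where
  "der \<equiv> smul [:0, 1:]"

text \<open>An element of \<open>\<complex>[\<lambda>] \<otimes> L\<close> is an \<open>L\<close>-valued polynomial in \<open>\<lambda>\<close>. The next function substitutes
  \<open>q \<in> \<complex>[\<partial>]\<close> for \<open>\<lambda>\<close>, where \<open>q\<close> acts on the coefficients; \<open>q = [:\<lambda>:]\<close> is the value at \<open>\<lambda> \<in> \<complex>\<close>, and
  \<open>q = [:-\<lambda>, -1:]\<close> is the substitution of \<open>-\<lambda>-\<partial>\<close>.\<close>

definition subst :: "complex poly \<Rightarrow> 'a poly \<Rightarrow> 'a" where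
  "subst q Z = (\<Sum>n\<le>degree Z. smul (q ^ n) (coeff Z n))"

abbreviation val :: "complex \<Rightarrow> 'a poly \<Rightarrow> 'a" where
  "val l \<equiv> subst [:l:]"

text \<open>For submodules \<open>N \<subseteq> M\<close>, the following two definitions describe the quotient \<open>M / N\<close> by
  representatives: the preimage in \<open>M\<close> of the torsion submodule of \<open>M / N\<close>, and the existence of
  finitely many elements of \<open>M / N\<close> which freely generate a complement of that torsion submodule.
  Directness of the sum follows from freeness.\<close>

definition torsion_mod :: "'a set \<Rightarrow> 'a set \<Rightarrow> 'a set" where
  "torsion_mod M N = {x \<in> M. \<exists>p. p \<noteq> 0 \<and> smul p x \<in> N}"

definition finite_rank_mod :: "'a set \<Rightarrow> 'a set \<Rightarrow> bool" where
  "finite_rank_mod M N \<longleftrightarrow>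
     (\<exists>(n::nat) a. (\<forall>i<n. a i \<in> M)
        \<and> (\<forall>p. (\<Sum>i<n. smul (p i) (a i)) \<in> N \<longrightarrow> (\<forall>i<n. p i = 0))
        \<and> M = {(\<Sum>i<n. smul (p i) (a i)) + t | p t. t \<in> torsion_mod M N})"

abbreviation finite_rank :: "'a set \<Rightarrow> bool" where
  "finite_rank M \<equiv> finite_rank_mod M {0}"

definition conf_dual :: "('a \<Rightarrow> complex poly) set" where
  "conf_dual = {f. clinear f \<and> (\<forall>u. f (der u) = [:0, 1:] * f u)}"

definition tensor_der :: "('a, 'a) tensor \<Rightarrow> ('a, 'a) tensor" where
  "tensor_der = tensor_lift (\<lambda>u v. der u \<otimes> v + u \<otimes> der v)"

definition tensor_smul :: "complex poly \<Rightarrow> ('a, 'a) tensor \<Rightarrow> ('a, 'a) tensor" where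
  "tensor_smul p t = (\<Sum>n\<le>degree p. coeff p n *\<^sub>C (tensor_der ^^ n) t)"

lemma clinear_smul: "clinear (smul p)"
  by (rule clinearI) (simp_all add: scale_right_distrib mult.commute flip: smul_const)

lemma subst_superset:
  assumes "degree Z \<le> N" shows "subst q Z = (\<Sum>n\<le>N. smul (q ^ n) (coeff Z n))"
  unfolding subst_def
  by (rule sum.mono_neutral_left) (use assms in \<open>auto simp: coeff_eq_0\<close>)

lemma clinear_subst: "clinear (subst q)"
proof (rule clinearI)
  fix x y :: "'a poly" and c
  let ?N = "max (degree x) (degree y)"
  have "degree (x + y) \<le> ?N" by (rule degree_add_le_max)
  then show "subst q (x + y) = subst q x + subst q y"
    by (simp add: subst_superset[of _ ?N] scale_right_distrib sum.distrib)
  have "degree (c *\<^sub>C x) \<le> degree x"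
    by (rule degree_le) (simp add: coeff_eq_0)
  then show "subst q (c *\<^sub>C x) = c *\<^sub>C subst q x"
    by (simp add: subst_superset[of _ "degree x"] cv.scale_sum_right clinear_scale[OF clinear_smul])
qed

end

definition conf_dual_smul :: "complex poly \<Rightarrow> ('a \<Rightarrow> complex poly) \<Rightarrow> 'a \<Rightarrow> complex poly" where
  "conf_dual_smul p f = (\<lambda>u. pcompose p [:0, -1:] * f u)"

interpretation conf_dual: dmodule "conf_dual_smul :: complex poly \<Rightarrow> ('a \<Rightarrow> complex poly) \<Rightarrow> _"
  by unfold_locales
    (simp_all add: conf_dual_smul_def fun_eq_iff scaleC_fun_def scaleC_complex_poly pcompose_add
      pcompose_mult pcompose_1 algebra_simps)


section \<open>Differential Lie coalgebras\<close>

text \<open>The carrier \<open>C\<close> is a submodule of an ambient module, and \<open>\<delta>\<close> is only meaningful on \<open>C\<close>.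
  In the last axiom all terms are moved to \<open>(C \<otimes> C) \<otimes> C\<close>.\<close>

locale differential_lie_coalgebra = dmodule smul
  for smul :: "complex poly \<Rightarrow> 'a::complex_vector \<Rightarrow> 'a" +
  fixes C :: "'a set" and \<delta> :: "'a \<Rightarrow> ('a, 'a) tensor"
  assumes subspace_carrier: "subspace C"
    and coproduct_closed: "x \<in> C \<Longrightarrow> \<delta> x \<in> tensor_sub C C"
    and coproduct_add: "x \<in> C \<Longrightarrow> y \<in> C \<Longrightarrow> \<delta> (x + y) = \<delta> x + \<delta> y"
    and coproduct_smul: "x \<in> C \<Longrightarrow> \<delta> (smul p x) = tensor_smul p (\<delta> x)"
    and anticommutative: "x \<in> C \<Longrightarrow> tensor_swap (\<delta> x) = - \<delta> x"
    and coJacobi: "x \<in> C \<Longrightarrow>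
      (let t = tensor_assoc (tensor_lift_on C C (\<lambda>a b. a \<otimes> \<delta> b) (\<delta> x))
       in t - tensor_lift (\<lambda>u c. tensor_swap u \<otimes> c) t
            = tensor_lift_on C C (\<lambda>a b. \<delta> a \<otimes> b) (\<delta> x))"
begin

definition subcoalgebra :: "'a set \<Rightarrow> bool" where
  "subcoalgebra B \<longleftrightarrow> subspace B \<and> B \<subseteq> C \<and> \<delta> ` B \<subseteq> tensor_sub B B"

definition Loc :: "'a set" where
  "Loc = span (\<Union>{B. subcoalgebra B \<and> finite_rank B})"

end


section \<open>Lie conformal algebras\<close>

text \<open>Identities between polynomials in \<open>\<lambda>\<close>, \<open>\<mu>\<close> are stated as identities between their values at all
  complex numbers \<open>l\<close>, \<open>m\<close>; these are equivalent because \<open>\<complex>\<close> is infinite.\<close>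

locale lie_conformal_algebra = dmodule smul
  for smul :: "complex poly \<Rightarrow> 'a::complex_vector \<Rightarrow> 'a" +
  fixes br :: "'a \<Rightarrow> 'a \<Rightarrow> 'a poly"
  assumes br_bilinear: "cbilinear br"
    and br_der_left: "val l (br (der a) b) = - (l *\<^sub>C val l (br a b))"
    and br_der_right: "val l (br a (der b)) = l *\<^sub>C val l (br a b) + der (val l (br a b))"
    and br_skew: "val l (br a b) = - subst [:-l, -1:] (br b a)"
    and br_Jacobi: "val l (br a (val m (br b c)))
      = val (l + m) (br (val l (br a b)) c) + val m (br b (val l (br a c)))"
begin

definition ideal :: "'a set \<Rightarrow> bool" where
  "ideal I \<longleftrightarrow> subspace I \<and> (\<forall>a. \<forall>b\<in>I. \<forall>n. coeff (br a b) n \<in> I)"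

definition cofinite_rank :: "'a set \<Rightarrow> bool" where
  "cofinite_rank I \<longleftrightarrow> finite_rank_mod UNIV I"

definition coproduct_of ::
    "('a \<Rightarrow> complex poly) \<Rightarrow> ('a \<Rightarrow> complex poly, 'a \<Rightarrow> complex poly) tensor \<Rightarrow> bool" where
  "coproduct_of f t \<longleftrightarrow>
     (\<forall>a b l m. poly (f (val m (br a b))) l
        = tensor_lift (\<lambda>f1 f2. poly (f1 a) (-m) * poly (f2 b) (l + m)) t)"

definition good :: "('a \<Rightarrow> complex poly) set \<Rightarrow> bool" where
  "good V \<longleftrightarrow> conf_dual.subspace V \<and> V \<subseteq> conf_dual
     \<and> (\<forall>f\<in>V. \<exists>t\<in>tensor_sub V V. coproduct_of f t)"

definition coproduct ::
    "('a \<Rightarrow> complex poly) set \<Rightarrow> ('a \<Rightarrow> complex poly)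
      \<Rightarrow> ('a \<Rightarrow> complex poly, 'a \<Rightarrow> complex poly) tensor" where
  "coproduct V f = (THE t. t \<in> tensor_sub V V \<and> coproduct_of f t)"

text \<open>The largest good submodule \<open>L\<^sup>0\<close>.\<close>

definition L0 :: "('a \<Rightarrow> complex poly) set" where
  "L0 = conf_dual.span (\<Union>{V. good V})"

definition Loc_L0 :: "('a \<Rightarrow> complex poly) set" where
  "Loc_L0 = differential_lie_coalgebra.Loc conf_dual_smul L0 (coproduct L0)"

end


section \<open>Lie algebras and their good subspaces\<close>

locale complex_lie_algebra =
  fixes lb :: "'a::complex_vector \<Rightarrow> 'a \<Rightarrow> 'a"
  assumes lb_bilinear: "cbilinear lb"
    and lb_self: "lb x x = 0"
    and lb_Jacobi: "lb x (lb y z) = lb (lb x y) z + lb y (lb x z)"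
begin

definition coproduct_of :: "('a \<Rightarrow> complex) \<Rightarrow> ('a \<Rightarrow> complex, 'a \<Rightarrow> complex) tensor \<Rightarrow> bool" where
  "coproduct_of \<phi> t \<longleftrightarrow> (\<forall>x y. \<phi> (lb x y) = tensor_lift (\<lambda>\<phi>1 \<phi>2. \<phi>1 x * \<phi>2 y) t)"

definition good_subspace :: "('a \<Rightarrow> complex) set \<Rightarrow> bool" where
  "good_subspace V \<longleftrightarrow> cv.subspace V \<and> V \<subseteq> {\<phi>. clinear \<phi>}
     \<and> (\<forall>\<phi>\<in>V. \<exists>t\<in>tensor_sub V V. coproduct_of \<phi> t)"

definition coproduct ::
    "('a \<Rightarrow> complex) set \<Rightarrow> ('a \<Rightarrow> complex) \<Rightarrow> ('a \<Rightarrow> complex, 'a \<Rightarrow> complex) tensor" where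
  "coproduct V \<phi> = (THE t. t \<in> tensor_sub V V \<and> coproduct_of \<phi> t)"

lemma lb_skew: "lb x y = - lb y x"
proof -
  have "lb (x + y) (x + y) = lb x x + lb x y + (lb y x + lb y y)"
    by (simp only: clinear_add[OF cbilinearD(1)[OF lb_bilinear]]
        clinear_add[OF cbilinearD(2)[OF lb_bilinear]] ac_simps)
  then have "lb x y + lb y x = 0" by (simp add: lb_self)
  then show ?thesis by (simp add: eq_neg_iff_add_eq_0)
qed

end


section \<open>Current algebras\<close>

text \<open>\<open>Cur(V) = \<complex>[\<partial>] \<otimes> V\<close>; for a subspace \<open>W\<close> of \<open>V\<close>, \<open>Cur(W)\<close> is a subset of it.\<close>

type_synonym 'v cur = "(complex poly, 'v) tensor"

definition Cur :: "'v::complex_vector set \<Rightarrow> 'v cur set" where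
  "Cur W = tensor_sub UNIV W"

definition cur_smul :: "complex poly \<Rightarrow> 'v::complex_vector cur \<Rightarrow> 'v cur" where
  "cur_smul p = tensor_lift (\<lambda>q v. (p * q) \<otimes> v)"

text \<open>\<open>f(-\<lambda>) g(\<lambda> + \<partial>)\<close> as a polynomial in \<open>\<lambda>\<close> with coefficients in \<open>\<complex>[\<partial>]\<close>.\<close>

definition cur_coeff :: "complex poly \<Rightarrow> complex poly \<Rightarrow> complex poly poly" where
  "cur_coeff f g =
     map_poly (\<lambda>c. [:c:]) (pcompose f [:0, -1:])
       * pcompose (map_poly (\<lambda>c. [:c:]) g) [:[:0, 1:], 1:]"

definition cur_bracket ::
    "('v::complex_vector \<Rightarrow> 'v \<Rightarrow> 'v) \<Rightarrow> 'v cur \<Rightarrow> 'v cur \<Rightarrow> 'v cur poly" where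
  "cur_bracket lb x y =
     tensor_lift (\<lambda>f a. tensor_lift (\<lambda>g b. map_poly (\<lambda>q. q \<otimes> lb a b) (cur_coeff f g)) y) x"

definition theta :: "('v::complex_vector \<Rightarrow> complex) cur \<Rightarrow> 'v cur \<Rightarrow> complex poly" where
  "theta x y =
     tensor_lift (\<lambda>q \<phi>. tensor_lift (\<lambda>p v. smult (\<phi> v) (pcompose q [:0, -1:] * p)) y) x"

lemma cur_smul_bilinear: "cbilinear (\<lambda>q v. (p * q) \<otimes> v)" for p :: "complex poly"
  unfolding cbilinear_def
  by (auto intro!: clinearI simp: pure_tensor_simps distrib_left scaleC_complex_poly)
    (simp add: pure_tensor_simps flip: scaleC_complex_poly)

lemma cur_smul_pure [simp]: "cur_smul p (q \<otimes> v) = (p * q) \<otimes> v"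
  unfolding cur_smul_def by (rule tensor_lift_pure[OF cur_smul_bilinear])

lemma clinear_cur_smul: "clinear (cur_smul p)"
  unfolding cur_smul_def by (rule tensor_lift_clinear[OF cur_smul_bilinear])

interpretation cur: dmodule "cur_smul :: complex poly \<Rightarrow> 'v::complex_vector cur \<Rightarrow> _"
proof
  fix p q :: "complex poly" and x y :: "'v cur" and c
  show "cur_smul p (x + y) = cur_smul p x + cur_smul p y"
    by (rule clinear_add[OF clinear_cur_smul])
  show "cur_smul (p + q) x = cur_smul p x + cur_smul q x"
    by (rule tensor_ext[where t = x])
      (simp_all add: clinear_cur_smul clinear_plus distrib_right pure_tensor_simps)
  show "cur_smul p (cur_smul q x) = cur_smul (p * q) x"
    by (rule tensor_ext[where t = x])
      (simp_all add: clinear_cur_smul clinear_compose mult.assoc)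
  show "cur_smul 1 x = x"
    by (rule tensor_ext[where t = x]) (simp_all add: clinear_cur_smul clinear_id)
  show "cur_smul [:c:] x = c *\<^sub>C x"
    by (rule tensor_ext[where t = x])
      (simp_all add: clinear_cur_smul clinear_id clinear_mult pure_tensor_simps
        flip: scaleC_complex_poly)
qed

lemma poly_cur_coeff: "poly (cur_coeff f g) q = pcompose f (-q) * pcompose g (q + [:0, 1:])"
  by (simp add: cur_coeff_def poly_pcompose add.commute flip: pcompose_altdef pcompose_assoc)
    (simp add: pcompose_pCons)

lemma clinear_map_poly:
  assumes "clinear f" shows "clinear (map_poly f)"
  by (rule clinearI)
    (simp_all add: poly_eq_iff coeff_map_poly clinear_0 clinear_add clinear_scale assms)

lemma map_poly_pure_add:
  "map_poly (\<lambda>q. q \<otimes> w) (Z + Z') = map_poly (\<lambda>q. q \<otimes> w) Z + map_poly (\<lambda>q. q \<otimes> w) Z'"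
  by (simp add: poly_eq_iff coeff_map_poly pure_tensor_simps)

lemma map_poly_pure_scale:
  "map_poly (\<lambda>q. q \<otimes> w) (smult [:c:] Z) = c *\<^sub>C map_poly (\<lambda>q. q \<otimes> w) Z"
  by (simp add: poly_eq_iff coeff_map_poly pure_tensor_simps flip: scaleC_complex_poly)

lemma cur_coeff_add_left: "cur_coeff (f + f') g = cur_coeff f g + cur_coeff f' g"
  and cur_coeff_add_right: "cur_coeff f (g + g') = cur_coeff f g + cur_coeff f g'"
  and cur_coeff_smult_left: "cur_coeff (smult c f) g = smult [:c:] (cur_coeff f g)"
  and cur_coeff_smult_right: "cur_coeff f (smult c g) = smult [:c:] (cur_coeff f g)"
proof -
  have add: "map_poly (\<lambda>c. [:c:]) (p + q) = map_poly (\<lambda>c. [:c:]) p + map_poly (\<lambda>c. [:c:]) q"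
    for p q :: "complex poly"
    by (simp add: poly_eq_iff coeff_map_poly)
  have smult: "map_poly (\<lambda>c. [:c:]) (smult c p) = smult [:c:] (map_poly (\<lambda>c. [:c:]) p)"
    for c and p :: "complex poly"
    by (simp add: poly_eq_iff coeff_map_poly mult.commute)
  show "cur_coeff (f + f') g = cur_coeff f g + cur_coeff f' g"
    and "cur_coeff f (g + g') = cur_coeff f g + cur_coeff f g'"
    and "cur_coeff (smult c f) g = smult [:c:] (cur_coeff f g)"
    and "cur_coeff f (smult c g) = smult [:c:] (cur_coeff f g)"
    by (simp_all add: cur_coeff_def add smult pcompose_add pcompose_smult algebra_simps)
qed

lemma subst_map_poly_pure: "cur.subst q (map_poly (\<lambda>r. r \<otimes> w) Z) = poly Z q \<otimes> w"
proof -
  have sum: "(\<Sum>n\<in>A. h n) \<otimes> w = (\<Sum>n\<in>A. h n \<otimes> w)" for A :: "nat set" and h :: "nat \<Rightarrow> complex poly"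
    by (induction A rule: infinite_finite_induct) (simp_all add: pure_tensor_simps)
  have "cur.subst q (map_poly (\<lambda>r. r \<otimes> w) Z)
      = (\<Sum>n\<le>degree Z. (q ^ n * coeff Z n) \<otimes> w)"
    by (subst cur.subst_superset[where N = "degree Z"])
      (simp_all add: map_poly_degree_leq coeff_map_poly pure_tensor_simps)
  also have "\<dots> = (\<Sum>n\<le>degree Z. q ^ n * coeff Z n) \<otimes> w"
    by (simp add: sum)
  finally show ?thesis by (simp add: poly_altdef mult.commute)
qed

context complex_lie_algebra
begin

lemmas lb_simps =
  clinear_add[OF cbilinearD(1)[OF lb_bilinear]] clinear_add[OF cbilinearD(2)[OF lb_bilinear]]
  clinear_scale[OF cbilinearD(1)[OF lb_bilinear]] clinear_scale[OF cbilinearD(2)[OF lb_bilinear]]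

lemma map_poly_lb:
  "map_poly (\<lambda>q. q \<otimes> lb (a + a') b) Z = map_poly (\<lambda>q. q \<otimes> lb a b) Z + map_poly (\<lambda>q. q \<otimes> lb a' b) Z"
  "map_poly (\<lambda>q. q \<otimes> lb a (b + b')) Z = map_poly (\<lambda>q. q \<otimes> lb a b) Z + map_poly (\<lambda>q. q \<otimes> lb a b') Z"
  "map_poly (\<lambda>q. q \<otimes> lb (c *\<^sub>C a) b) Z = c *\<^sub>C map_poly (\<lambda>q. q \<otimes> lb a b) Z"
  "map_poly (\<lambda>q. q \<otimes> lb a (c *\<^sub>C b)) Z = c *\<^sub>C map_poly (\<lambda>q. q \<otimes> lb a b) Z"
  by (simp_all add: poly_eq_iff coeff_map_poly pure_tensor_simps lb_simps)

lemma cur_bracket_inner: "cbilinear (\<lambda>g b. map_poly (\<lambda>q. q \<otimes> lb a b) (cur_coeff f g))"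
  unfolding cbilinear_def
  by (auto intro!: clinearI simp: map_poly_lb cur_coeff_add_right cur_coeff_smult_right
      map_poly_pure_add map_poly_pure_scale scaleC_complex_poly)

lemma cur_bracket_outer:
  "cbilinear (\<lambda>f a. tensor_lift (\<lambda>g b. map_poly (\<lambda>q. q \<otimes> lb a b) (cur_coeff f g)) y)"
  unfolding cbilinear_def
  by (auto intro!: clinearI simp: map_poly_lb cur_coeff_add_left cur_coeff_smult_left
      map_poly_pure_add map_poly_pure_scale scaleC_complex_poly
      tensor_lift_on_add tensor_lift_on_scale)

lemma cur_bracket_pure:
  "cur_bracket lb (f \<otimes> a) (g \<otimes> b) = map_poly (\<lambda>q. q \<otimes> lb a b) (cur_coeff f g)"
  unfolding cur_bracket_def tensor_lift_pure[OF cur_bracket_outer]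
  by (rule tensor_lift_pure[OF cur_bracket_inner])

lemma cur_bracket_bilinear: "cbilinear (cur_bracket lb)"
proof -
  have r: "clinear (\<lambda>x. cur_bracket lb x y)" for y
    unfolding cur_bracket_def by (rule tensor_lift_clinear[OF cur_bracket_outer])
  have l: "clinear (\<lambda>y. cur_bracket lb (f \<otimes> a) y)" for f a
    unfolding cur_bracket_def tensor_lift_pure[OF cur_bracket_outer]
    by (rule tensor_lift_clinear[OF cur_bracket_inner])
  have "cur_bracket lb x (y + z) = cur_bracket lb x y + cur_bracket lb x z" for x y z
    by (rule tensor_ext[where t = x]) (simp_all add: r clinear_plus clinear_add[OF l])
  moreover have "cur_bracket lb x (c *\<^sub>C y) = c *\<^sub>C cur_bracket lb x y" for x y c
    by (rule tensor_ext[where t = x]) (simp_all add: r clinear_mult clinear_scale[OF l])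
  ultimately show ?thesis
    unfolding cbilinear_def using r by (auto intro: clinearI)
qed

lemma subst_cur_bracket_pure:
  "cur.subst q (cur_bracket lb (f \<otimes> a) (g \<otimes> b))
     = (pcompose f (-q) * pcompose g (q + [:0, 1:])) \<otimes> lb a b"
  by (simp add: cur_bracket_pure subst_map_poly_pure poly_cur_coeff)

sublocale cur: lie_conformal_algebra cur_smul "cur_bracket lb"
proof
  note B = cbilinearD[OF cur_bracket_bilinear]
  note lin = clinear_compose[OF cur.clinear_subst] clinear_compose[OF clinear_cur_smul]
    clinear_compose[OF B(1)] clinear_compose[OF B(2)]
    clinear_cur_smul B clinear_plus clinear_uminus clinear_mult clinear_id
  have uminus: "- (q \<otimes> w) = (- q) \<otimes> w" "q \<otimes> (- w) = (- q) \<otimes> w" for q :: "complex poly" and w :: 'a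
    using pure_tensor_simps(4)[of "-1" q w] pure_tensor_simps(3)[of q "-1" w] by simp_all
  have scale: "c *\<^sub>C (q \<otimes> w) = smult c q \<otimes> w" for q :: "complex poly" and w :: 'a and c
    by (simp add: pure_tensor_simps flip: scaleC_complex_poly)
  have add: "q \<otimes> w + q' \<otimes> w = (q + q') \<otimes> w" for q q' :: "complex poly" and w :: 'a
    by (simp add: pure_tensor_simps)
  note ps = subst_cur_bracket_pure pcompose_mult pcompose_pCons uminus scale add
  fix x y z :: "'a cur" and l m :: complex
  show "cbilinear (cur_bracket lb)"
    by (rule cur_bracket_bilinear)
  show "cur.val l (cur_bracket lb (cur.der x) y) = - (l *\<^sub>C cur.val l (cur_bracket lb x y))"
  proof (rule tensor_ext[where t = x], goal_cases)
    case (3 f a)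
    show ?case
    proof (rule tensor_ext[where t = y], goal_cases)
      case (3 g b)
      show ?case by (simp add: ps)
    qed (intro lin)+
  qed (intro lin)+
  show "cur.val l (cur_bracket lb x (cur.der y))
      = l *\<^sub>C cur.val l (cur_bracket lb x y) + cur.der (cur.val l (cur_bracket lb x y))"
  proof (rule tensor_ext[where t = x], goal_cases)
    case (3 f a)
    show ?case
    proof (rule tensor_ext[where t = y], goal_cases)
      case (3 g b)
      show ?case by (simp add: ps algebra_simps)
    qed (intro lin)+
  qed (intro lin)+
  show "cur.val l (cur_bracket lb x y) = - cur.subst [:-l, -1:] (cur_bracket lb y x)"
  proof (rule tensor_ext[where t = x], goal_cases)
    case (3 f a)
    show ?case
    proof (rule tensor_ext[where t = y], goal_cases)
      case (3 g b)
      show ?case by (simp add: ps lb_skew[of a b] mult.commute)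
    qed (intro lin)+
  qed (intro lin)+
  show "cur.val l (cur_bracket lb x (cur.val m (cur_bracket lb y z)))
      = cur.val (l + m) (cur_bracket lb (cur.val l (cur_bracket lb x y)) z)
        + cur.val m (cur_bracket lb y (cur.val l (cur_bracket lb x z)))"
  proof (rule tensor_ext[where t = x], goal_cases)
    case (3 f a)
    show ?case
    proof (rule tensor_ext[where t = y], goal_cases)
      case (3 g b)
      show ?case
      proof (rule tensor_ext[where t = z], goal_cases)
        case (3 h c)
        show ?case
          by (simp add: subst_cur_bracket_pure lb_Jacobi[of a b c] pure_tensor_simps
              pcompose_mult pcompose_pCons flip: pcompose_assoc)
            (simp add: ac_simps)
      qed (intro lin)+
    qed (intro lin)+
  qed (intro lin)+
qed

end


section \<open>The Lie algebra with basis \<open>e\<^sub>0, e\<^sub>1, \<dots>\<close>\<close>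

type_synonym g_space = "nat \<Rightarrow>\<^sub>0 complex"

definition basis_e :: "nat \<Rightarrow> g_space" where
  "basis_e i = Poly_Mapping.single i 1"

definition e_star :: "nat \<Rightarrow> g_space \<Rightarrow> complex" where
  "e_star i x = Poly_Mapping.lookup x i"

definition basis_bracket :: "nat \<Rightarrow> nat \<Rightarrow> g_space" where
  "basis_bracket i j =
     (if i = 0 \<and> 2 \<le> j then basis_e (j - 1) else if 2 \<le> i \<and> j = 0 then - basis_e (i - 1) else 0)"

definition g_bracket :: "g_space \<Rightarrow> g_space \<Rightarrow> g_space" where
  "g_bracket x y =
     (\<Sum>i\<in>Poly_Mapping.keys x. \<Sum>j\<in>Poly_Mapping.keys y.
        (Poly_Mapping.lookup x i * Poly_Mapping.lookup y j) *\<^sub>C basis_bracket i j)"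

lemma g_bracket_basis: "g_bracket (basis_e i) (basis_e j) = basis_bracket i j"
  by (simp add: g_bracket_def basis_e_def scaleC_one)

lemma e_star_basis: "e_star i (basis_e j) = (if i = j then 1 else 0)"
  by (simp add: e_star_def basis_e_def lookup_single when_def)

lemma g_bracket_superset:
  assumes "finite S" "finite T" "Poly_Mapping.keys x \<subseteq> S" "Poly_Mapping.keys y \<subseteq> T"
  shows "g_bracket x y =
    (\<Sum>i\<in>S. \<Sum>j\<in>T. (Poly_Mapping.lookup x i * Poly_Mapping.lookup y j) *\<^sub>C basis_bracket i j)"
proof -
  have "(\<Sum>j\<in>T. (Poly_Mapping.lookup x i * Poly_Mapping.lookup y j) *\<^sub>C basis_bracket i j)
      = (\<Sum>j\<in>Poly_Mapping.keys y.
          (Poly_Mapping.lookup x i * Poly_Mapping.lookup y j) *\<^sub>C basis_bracket i j)" for i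
    by (rule sum.mono_neutral_right) (use assms in \<open>auto simp: in_keys_iff\<close>)
  then show ?thesis
    unfolding g_bracket_def
    by (simp, intro sum.mono_neutral_left) (use assms in \<open>auto simp: in_keys_iff\<close>)
qed

lemma g_bracket_bilinear: "cbilinear g_bracket"
  unfolding cbilinear_def
proof (intro conjI allI clinearI)
  fix x y z :: g_space and c
  let ?k = Poly_Mapping.keys
  let ?S = "?k x \<union> ?k y \<union> ?k z"
  have fin: "finite ?S" by simp
  have sub: "?k x \<subseteq> ?S" "?k y \<subseteq> ?S" "?k z \<subseteq> ?S" "?k (y + z) \<subseteq> ?S" "?k (c *\<^sub>C y) \<subseteq> ?S"
    using Poly_Mapping.keys_add[of y z] by (auto simp: in_keys_iff)
  note ex = g_bracket_superset[OF fin fin]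
  show "g_bracket x (y + z) = g_bracket x y + g_bracket x z"
    by (simp only: ex[OF sub(1,4)] ex[OF sub(1,2)] ex[OF sub(1,3)])
      (simp add: lookup_add distrib_left scaleC_add_left sum.distrib)
  show "g_bracket (y + z) x = g_bracket y x + g_bracket z x"
    by (simp only: ex[OF sub(4,1)] ex[OF sub(2,1)] ex[OF sub(3,1)])
      (simp add: lookup_add distrib_right scaleC_add_left sum.distrib)
  show "g_bracket x (c *\<^sub>C y) = c *\<^sub>C g_bracket x y"
    by (simp only: ex[OF sub(1,5)] ex[OF sub(1,2)])
      (simp add: cv.scale_sum_right scaleC_scaleC scaleC_complex_def ac_simps)
  show "g_bracket (c *\<^sub>C y) x = c *\<^sub>C g_bracket y x"
    by (simp only: ex[OF sub(5,1)] ex[OF sub(2,1)])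
      (simp add: cv.scale_sum_right scaleC_scaleC scaleC_complex_def ac_simps)
qed

lemma g_ext:
  assumes "clinear f" "clinear h" "\<And>i. f (basis_e i) = h (basis_e i)"
  shows "f x = h x"
proof (induction x rule: update_induct)
  case const
  then show ?case using assms by (simp add: clinear_0)
next
  case (update x i c)
  have "Poly_Mapping.update i c x = x + c *\<^sub>C basis_e i"
    using update(1)
    by (intro poly_mapping_eqI)
      (auto simp: basis_e_def lookup_add lookup_single lookup_update when_def scaleC_complex_def
        in_keys_iff)
  then show ?case using update(3) assms by (simp add: clinear_add clinear_scale)
qed

interpretation g: complex_lie_algebra g_bracket
proof
  note B = cbilinearD[OF g_bracket_bilinear]
  note lin = clinear_compose[OF B(1)] clinear_compose[OF B(2)] B clinear_plus clinear_uminus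
  have um: "g_bracket (- u) v = - g_bracket u v" "g_bracket v (- u) = - g_bracket v u"
    "g_bracket 0 v = 0" "g_bracket v 0 = 0" for u v
    using clinear_scale[OF B(1), of v "-1" u] clinear_scale[OF B(2), of "-1" u v]
      clinear_0[OF B(1), of v] clinear_0[OF B(2), of v] by simp_all
  fix x y z :: g_space
  show "cbilinear g_bracket" by (rule g_bracket_bilinear)
  have "g_bracket x y = - g_bracket y x" for x y
  proof (rule g_ext[where x = x], goal_cases)
    case (3 i)
    show ?case
    proof (rule g_ext[where x = y], goal_cases)
      case (3 j)
      show ?case by (auto simp: g_bracket_basis basis_bracket_def)
    qed (intro lin)+
  qed (intro lin)+
  from this[of x x] have "2 *\<^sub>C g_bracket x x = 0"
    using scaleC_add_left[of 1 1 "g_bracket x x"] by simp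
  then show "g_bracket x x = 0" by simp
  show "g_bracket x (g_bracket y z) = g_bracket (g_bracket x y) z + g_bracket y (g_bracket x z)"
  proof (rule g_ext[where x = x], goal_cases)
    case (3 i)
    show ?case
    proof (rule g_ext[where x = y], goal_cases)
      case (3 j)
      show ?case
      proof (rule g_ext[where x = z], goal_cases)
        case (3 k)
        show ?case by (auto simp: g_bracket_basis basis_bracket_def um)
      qed (intro lin)+
    qed (intro lin)+
  qed (intro lin)+
qed

definition J :: "complex poly \<Rightarrow> g_space cur set" where
  "J a = {(a * p) \<otimes> basis_e 0 + y | p y. y \<in> cv.span {q \<otimes> basis_e i | q i. 1 \<le> i}}"

end

theory Submission
  imports Defs
begin

text \<open>Let \<open>K\<close> be the submodule generated by the \<open>e\<^sub>i\<close> with \<open>i \<ge> 1\<close>; it contains all brackets. If an ideal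
  contains, for every \<open>N\<close>, a nonzero combination of elements \<open>e\<^sub>i\<close> with \<open>i \<ge> N\<close>, then bracketing with
  \<open>e\<^sub>0\<close>, which lowers indices by one, shows that it contains \<open>K\<close>. An ideal of cofinite rank is of
  this kind, as finitely many equations in more unknowns have a nontrivial solution; the ideals above
  \<open>K\<close> correspond to those of \<open>\<complex>[\<partial>]\<close>. Likewise, the annihilator of a good submodule of finite rank is an
  ideal of this kind, hence the submodule vanishes on \<open>K\<close> and lies in \<open>\<complex>[\<partial>] e\<^sub>0\<^sup>*\<close>. As the coproduct of
  \<open>e\<^sub>i\<^sup>*\<close> only involves \<open>e\<^sub>0\<^sup>*\<close> and \<open>e\<^sub>i\<^sub>+\<^sub>1\<^sup>*\<close>, all the \<open>e\<^sub>i\<^sup>*\<close> together span a good submodule, which is not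
  contained in \<open>\<complex>[\<partial>] e\<^sub>0\<^sup>*\<close>.\<close>

section \<open>Tensor products and separating families of functionals\<close>

lemma clinear_sum: "clinear f \<Longrightarrow> f (sum h A) = (\<Sum>i\<in>A. f (h i))"
  by (induction A rule: infinite_finite_induct) (simp_all add: clinear_0 clinear_add)

lemma clinear_apply: "clinear (\<lambda>f. f x)"
  by (rule clinearI) (simp_all add: scaleC_fun_def)

lemma clinear_zero: "clinear (\<lambda>_. 0)"
  by (rule clinearI) simp_all

lemma cbilinear_mult:
  fixes f :: "'a::complex_vector \<Rightarrow> complex" and g :: "'b::complex_vector \<Rightarrow> complex"
  assumes "clinear f" "clinear g"
  shows "cbilinear (\<lambda>a b. f a * g b)"
  unfolding cbilinear_def
  by (intro conjI allI clinearI)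
    (simp_all add: clinear_add[OF assms(1)] clinear_add[OF assms(2)] clinear_scale[OF assms(1)]
      clinear_scale[OF assms(2)] scaleC_complex_def algebra_simps)

text \<open>The second factor of each new pure tensor is expanded in \<open>X\<close>, and the
  scalars move into the first factor. Below, \<open>X\<close> is either a basis of an abstract space
  or the set of all \<open>basis_e i\<close>.\<close>

lemma tensor_expansion:
  fixes t :: "('a::complex_vector, 'b::complex_vector) tensor"
  assumes span: "cv.span X = (UNIV :: 'b set)"
  shows "\<exists>F u. finite F \<and> F \<subseteq> X \<and> t = (\<Sum>k\<in>F. u k \<otimes> k)"
  using tensor_in_span_pure[of t]
proof (induction rule: cv.span_induct_alt)
  case base
  have "0 = (\<Sum>k\<in>{}. (undefined :: 'b \<Rightarrow> 'a) k \<otimes> k)" by simp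
  then show ?case by blast
next
  case (step c x y)
  then obtain a b F u where x: "x = a \<otimes> b" and F: "finite F" "F \<subseteq> X" "y = (\<Sum>k\<in>F. u k \<otimes> k)"
    by blast
  have "b \<in> cv.span X" by (simp add: span)
  then obtain T r where T: "finite T" "T \<subseteq> X" "b = (\<Sum>k\<in>T. r k *\<^sub>C k)"
    unfolding cv.span_explicit by blast
  \<comment> \<open>Both coefficient families are padded with 0 so that the two sums share the index
    set \<open>F \<union> T\<close>.\<close>
  define w where "w k = (if k \<in> F then u k else 0) + (if k \<in> T then (c * r k) *\<^sub>C a else 0)" for k
  have "y = (\<Sum>k\<in>F \<union> T. (if k \<in> F then u k else 0) \<otimes> k)"
    unfolding F(3) by (rule sum.mono_neutral_cong_left) (use F T in \<open>auto simp: pure_tensor_simps\<close>)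
  moreover have "c *\<^sub>C x = (\<Sum>k\<in>T. ((c * r k) *\<^sub>C a) \<otimes> k)"
    by (simp add: x T(3) clinear_sum[OF cbilinearD(1)[OF pure_tensor_bilinear]] pure_tensor_simps
        cv.scale_sum_right scaleC_scaleC)
  then have "c *\<^sub>C x = (\<Sum>k\<in>F \<union> T. (if k \<in> T then (c * r k) *\<^sub>C a else 0) \<otimes> k)"
    by (simp, intro sum.mono_neutral_cong_left) (use F T in \<open>auto simp: pure_tensor_simps\<close>)
  ultimately have "c *\<^sub>C x + y = (\<Sum>k\<in>F \<union> T. w k \<otimes> k)"
    by (simp add: w_def pure_tensor_simps sum.distrib add.commute)
  then show ?case using F T by (metis finite_UnI Un_least)
qed

text \<open>Expanding \<open>t\<close> along a basis of the second factor, linear independence forces all coefficients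
  in the first factor to be annihilated by \<open>S\<close>.\<close>

lemma tensor_separated:
  fixes t :: "('a::complex_vector, 'b::complex_vector) tensor"
    and S :: "('a \<Rightarrow> complex) set" and T :: "('b \<Rightarrow> complex) set"
  assumes lin: "\<And>f. f \<in> S \<Longrightarrow> clinear f" "\<And>g. g \<in> T \<Longrightarrow> clinear g"
    and sepS: "\<And>x. (\<And>f. f \<in> S \<Longrightarrow> f x = 0) \<Longrightarrow> x = 0"
    and sepT: "\<And>y. (\<And>g. g \<in> T \<Longrightarrow> g y = 0) \<Longrightarrow> y = 0"
    and t: "\<And>f g. f \<in> S \<Longrightarrow> g \<in> T \<Longrightarrow> tensor_lift (\<lambda>a b. f a * g b) t = 0"
  shows "t = 0"
proof -
  obtain X where X: "cv.independent X" "cv.span X = (UNIV :: 'b set)"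
    using cv.independent_extend_basis[OF cv.independent_empty]
      cv.span_extend_basis[OF cv.independent_empty] by blast
  obtain F u where F: "finite F" "F \<subseteq> X" "t = (\<Sum>k\<in>F. u k \<otimes> k)"
    using tensor_expansion[OF X(2)] by blast
  have "f (u k) = 0" if f: "f \<in> S" and k: "k \<in> F" for f k
  proof -
    \<comment> \<open>Applying \<open>f\<close> to the first factor of \<open>t\<close> leaves this
      vector of the second space, which every member of \<open>T\<close> annihilates.\<close>
    have "(\<Sum>k\<in>F. f (u k) *\<^sub>C k) = 0"
    proof (rule sepT)
      fix g assume g: "g \<in> T"
      note bil = cbilinear_mult[OF lin(1)[OF f] lin(2)[OF g]]
      have "g (\<Sum>k\<in>F. f (u k) *\<^sub>C k) = tensor_lift (\<lambda>a b. f a * g b) t"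
        by (simp add: F(3) clinear_sum[OF lin(2)[OF g]] clinear_sum[OF tensor_lift_clinear[OF bil]]
            tensor_lift_pure[OF bil] clinear_scale[OF lin(2)[OF g]] scaleC_complex_def)
      then show "g (\<Sum>k\<in>F. f (u k) *\<^sub>C k) = 0" by (simp add: t[OF f g])
    qed
    then show ?thesis
      using X(1) F(1,2) k unfolding cv.independent_explicit_finite_subsets
      by (elim allE[of _ F] impE allE[of _ "\<lambda>k. f (u k)"] ballE[of _ _ k]) auto
  qed
  then have "u k = 0" if "k \<in> F" for k using sepS that by blast
  then show ?thesis by (simp add: F(3) pure_tensor_simps)
qed

lemma tensor_sub_mono: "A \<subseteq> A' \<Longrightarrow> B \<subseteq> B' \<Longrightarrow> tensor_sub A B \<subseteq> tensor_sub A' B'"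
  unfolding tensor_sub_def by (rule cv.span_mono) blast

lemma tensor_sub_subspace: "cv.subspace (tensor_sub A B)"
  unfolding tensor_sub_def by (rule cv.subspace_span)

lemma pure_in_tensor_sub: "a \<in> A \<Longrightarrow> b \<in> B \<Longrightarrow> a \<otimes> b \<in> tensor_sub A B"
  unfolding tensor_sub_def by (rule cv.span_base) blast

lemma tensor_sub_ext:
  assumes "clinear f" "clinear g" "\<And>a b. a \<in> A \<Longrightarrow> b \<in> B \<Longrightarrow> f (a \<otimes> b) = g (a \<otimes> b)"
    and "t \<in> tensor_sub A B"
  shows "f t = g t"
  using assms(4) unfolding tensor_sub_def
proof (induction rule: cv.span_induct_alt)
  case base
  then show ?case using assms by (simp add: clinear_0)
next
  case (step c x y)
  then show ?case using assms by (auto simp: clinear_add clinear_scale)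
qed

lemma clinear_image_tensor_sub:
  assumes "clinear f" "\<And>a b. a \<in> A \<Longrightarrow> b \<in> B \<Longrightarrow> f (a \<otimes> b) \<in> U" "cv.subspace U"
    and "t \<in> tensor_sub A B"
  shows "f t \<in> U"
  using assms(4) unfolding tensor_sub_def
proof (induction rule: cv.span_induct_alt)
  case base
  then show ?case using assms by (simp add: clinear_0 cv.subspace_0)
next
  case (step c x y)
  then show ?case
    using assms by (auto simp: clinear_add clinear_scale cv.subspace_add cv.subspace_scale)
qed

text \<open>The representative chosen by \<^const>\<open>tensor_lift_on\<close> has its support in \<open>A \<times> B\<close>, where \<open>\<beta>\<close> may
  be replaced by an everywhere bilinear map.\<close>

lemma tensor_lift_on_eq:
  assumes bil: "cbilinear \<gamma>" and eq: "\<And>a b. a \<in> A \<Longrightarrow> b \<in> B \<Longrightarrow> \<beta> a b = \<gamma> a b"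
    and t: "t \<in> tensor_sub A B" and A: "cv.subspace A"
  shows "tensor_lift_on A B \<beta> t = tensor_lift \<gamma> t"
proof -
  have "\<exists>r. Poly_Mapping.keys r \<subseteq> A \<times> B \<and> abs_tensor r = t"
    using t unfolding tensor_sub_def
  proof (induction rule: cv.span_induct_alt)
    case base
    show ?case by (rule exI[of _ 0]) (simp add: zero_tensor.abs_eq)
  next
    case (step c x y)
    then obtain a b r where x: "x = a \<otimes> b" "a \<in> A" "b \<in> B"
      and r: "Poly_Mapping.keys r \<subseteq> A \<times> B" "abs_tensor r = y"
      by blast
    \<comment> \<open>The scalar is absorbed into the first factor; as \<open>A\<close> is a
      subspace, the new key stays in \<open>A \<times> B\<close>.\<close>
    have "c *\<^sub>C x + y = abs_tensor (Poly_Mapping.single (c *\<^sub>C a, b) 1 + r)"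
      by (simp add: x(1) plus_tensor.abs_eq[symmetric] pure_tensor.abs_eq[symmetric] r(2)
          pure_tensor_simps)
    moreover have "Poly_Mapping.keys (Poly_Mapping.single (c *\<^sub>C a, b) 1 + r) \<subseteq> A \<times> B"
      using Poly_Mapping.keys_add[of "Poly_Mapping.single (c *\<^sub>C a, b) (1::complex)" r] x r(1)
        cv.subspace_scale[OF A]
      by (auto split: if_splits)
    ultimately show ?case by metis
  qed
  then obtain r0 where r0: "Poly_Mapping.keys r0 \<subseteq> A \<times> B \<and> abs_tensor r0 = t" ..
  define r where "r = (SOME r. Poly_Mapping.keys r \<subseteq> A \<times> B \<and> abs_tensor r = t)"
  have r: "Poly_Mapping.keys r \<subseteq> A \<times> B" "abs_tensor r = t"
    using someI[of "\<lambda>r. Poly_Mapping.keys r \<subseteq> A \<times> B \<and> abs_tensor r = t", OF r0]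
    by (simp_all add: r_def)
  have "tensor_lift_on A B \<beta> t
      = (\<Sum>(a, b)\<in>Poly_Mapping.keys r. Poly_Mapping.lookup r (a, b) *\<^sub>C \<beta> a b)"
    by (simp add: tensor_lift_on_def r_def Let_def)
  also have "\<dots> = ext_lin \<gamma> r"
    unfolding ext_lin_def by (rule sum.cong) (use eq r(1) in auto)
  also have "\<dots> = tensor_lift \<gamma> t"
    using tensor_lift_abs[OF bil, of r] r(2) by simp
  finally show ?thesis .
qed

section \<open>The swap and the associativity isomorphism\<close>

lemma cbilinear_swap: "cbilinear (\<lambda>a b. b \<otimes> a)"
  unfolding cbilinear_def by (auto intro!: clinearI simp: pure_tensor_simps)

lemma clinear_tensor_swap: "clinear tensor_swap"
  unfolding tensor_swap_def by (rule tensor_lift_clinear[OF cbilinear_swap])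

lemma tensor_swap_pure: "tensor_swap (a \<otimes> b) = b \<otimes> a"
  unfolding tensor_swap_def by (rule tensor_lift_pure[OF cbilinear_swap])

lemma cbilinear_assoc_inner: "cbilinear (\<lambda>b c. (a \<otimes> b) \<otimes> c)"
  unfolding cbilinear_def by (auto intro!: clinearI simp: pure_tensor_simps)

text \<open>In \<open>a\<close> it is the lifted map that varies, so linearity comes from linearity
  of \<open>tensor_lift\<close> in the map rather than in the tensor.\<close>

lemma cbilinear_assoc_outer: "cbilinear (\<lambda>a. tensor_lift (\<lambda>b c. (a \<otimes> b) \<otimes> c))"
  unfolding cbilinear_def
proof (intro conjI allI clinearI)
  fix a a' :: 'a and t :: "('b, 'c) tensor" and k
  show "tensor_lift (\<lambda>b c. ((a + a') \<otimes> b) \<otimes> c) t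
      = tensor_lift (\<lambda>b c. (a \<otimes> b) \<otimes> c) t + tensor_lift (\<lambda>b c. (a' \<otimes> b) \<otimes> c) t"
    unfolding pure_tensor_simps by (rule tensor_lift_on_add)
  show "tensor_lift (\<lambda>b c. ((k *\<^sub>C a) \<otimes> b) \<otimes> c) t
      = k *\<^sub>C tensor_lift (\<lambda>b c. (a \<otimes> b) \<otimes> c) t"
    unfolding pure_tensor_simps by (rule tensor_lift_on_scale)
qed (simp_all add: clinear_add[OF tensor_lift_clinear[OF cbilinear_assoc_inner]]
      clinear_scale[OF tensor_lift_clinear[OF cbilinear_assoc_inner]])

lemma clinear_tensor_assoc: "clinear tensor_assoc"
  unfolding tensor_assoc_def by (rule tensor_lift_clinear[OF cbilinear_assoc_outer])

lemma tensor_assoc_pure: "tensor_assoc (a \<otimes> (b \<otimes> c)) = (a \<otimes> b) \<otimes> c"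
  unfolding tensor_assoc_def tensor_lift_pure[OF cbilinear_assoc_outer]
  by (rule tensor_lift_pure[OF cbilinear_assoc_inner])


section \<open>Coproducts on the conformal dual\<close>

lemma clinear_point_eval: "clinear (\<lambda>f. poly (f a) \<alpha>)"
  for \<alpha> :: complex
  by (rule clinearI) (simp_all add: scaleC_fun_def scaleC_complex_poly scaleC_complex_def[symmetric])

lemma conf_dual_smul_apply: "conf_dual_smul p f u = pcompose p [:0, -1:] * f u"
  by (simp add: conf_dual_smul_def)

text \<open>Polynomial identities between tensors of functionals are tested numerically, with an
  argument and an evaluation point for each factor.\<close>

definition point_pairing ::
    "'a \<Rightarrow> complex \<Rightarrow> 'b \<Rightarrow> complex \<Rightarrow> ('a \<Rightarrow> complex poly, 'b \<Rightarrow> complex poly) tensor \<Rightarrow> complex" where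
  "point_pairing a \<alpha> b \<beta> = tensor_lift (\<lambda>f g. poly (f a) \<alpha> * poly (g b) \<beta>)"

lemma clinear_point_pairing: "clinear (point_pairing a \<alpha> b \<beta>)"
  unfolding point_pairing_def
  by (intro tensor_lift_clinear cbilinear_mult clinear_point_eval)

lemma point_pairing_pure [simp]: "point_pairing a \<alpha> b \<beta> (f \<otimes> g) = poly (f a) \<alpha> * poly (g b) \<beta>"
  unfolding point_pairing_def
  by (rule tensor_lift_pure[OF cbilinear_mult[OF clinear_point_eval clinear_point_eval]])

lemma point_eval_separating:
  assumes "\<And>a \<alpha>. poly (f a) \<alpha> = 0" shows "f = (0 :: 'a \<Rightarrow> complex poly)"
  by (rule ext) (metis assms poly_all_0_iff_0 zero_fun_apply)

text \<open>A complex polynomial that vanishes everywhere is zero, so point evaluations separate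
  functions; \<open>tensor_separated\<close> passes this on to tensors.\<close>

lemma point_pairing_separating:
  assumes "\<And>a \<alpha> b \<beta>. point_pairing a \<alpha> b \<beta> t = 0" shows "t = 0"
  by (rule tensor_separated[where S = "{\<lambda>f. poly (f a) \<alpha> | a \<alpha>. True}"
      and T = "{\<lambda>f. poly (f a) \<alpha> | a \<alpha>. True}"])
    (use assms in \<open>auto simp: clinear_point_eval point_pairing_def intro!: point_eval_separating\<close>)

text \<open>Nested to the left because the co-Jacobi identity is stated in
  \<open>(C \<otimes> C) \<otimes> C\<close>.\<close>

definition triple_pairing ::
    "'a \<Rightarrow> complex \<Rightarrow> 'b \<Rightarrow> complex \<Rightarrow> 'c \<Rightarrow> complex \<Rightarrow>
      (('a \<Rightarrow> complex poly, 'b \<Rightarrow> complex poly) tensor, 'c \<Rightarrow> complex poly) tensor \<Rightarrow> complex" where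
  "triple_pairing a \<alpha> b \<beta> c \<gamma> = tensor_lift (\<lambda>u f. point_pairing a \<alpha> b \<beta> u * poly (f c) \<gamma>)"

lemma clinear_triple_pairing: "clinear (triple_pairing a \<alpha> b \<beta> c \<gamma>)"
  unfolding triple_pairing_def
  by (intro tensor_lift_clinear cbilinear_mult clinear_point_pairing clinear_point_eval)

lemma triple_pairing_pure [simp]:
  "triple_pairing a \<alpha> b \<beta> c \<gamma> (u \<otimes> f) = point_pairing a \<alpha> b \<beta> u * poly (f c) \<gamma>"
  unfolding triple_pairing_def
  by (rule tensor_lift_pure[OF cbilinear_mult[OF clinear_point_pairing clinear_point_eval]])

lemma triple_pairing_separating:
  assumes "\<And>a \<alpha> b \<beta> c \<gamma>. triple_pairing a \<alpha> b \<beta> c \<gamma> t = 0" shows "t = 0"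
  by (rule tensor_separated[where S = "{point_pairing a \<alpha> b \<beta> | a \<alpha> b \<beta>. True}"
      and T = "{\<lambda>f. poly (f a) \<alpha> | a \<alpha>. True}"])
    (use assms in \<open>auto simp: clinear_point_eval clinear_point_pairing triple_pairing_def
      intro!: point_eval_separating point_pairing_separating, blast\<close>)

lemma point_pairing_swap: "point_pairing a \<alpha> b \<beta> (tensor_swap t) = point_pairing b \<beta> a \<alpha> t"
  by (rule tensor_ext[where t = t])
    (simp_all add: clinear_compose[OF clinear_point_pairing clinear_tensor_swap]
      clinear_point_pairing tensor_swap_pure)

lemma triple_pairing_assoc:
  "triple_pairing a \<alpha> b \<beta> c \<gamma> (tensor_assoc t)
     = tensor_lift (\<lambda>f u. poly (f a) \<alpha> * point_pairing b \<beta> c \<gamma> u) t"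
proof -
  note bil = cbilinear_mult[OF clinear_point_eval clinear_point_pairing]
  have pure: "tensor_lift (\<lambda>f u. poly (f a) \<alpha> * point_pairing b \<beta> c \<gamma> u) (f \<otimes> u)
      = poly (f a) \<alpha> *\<^sub>C point_pairing b \<beta> c \<gamma> u" for f u
    by (simp add: tensor_lift_pure[OF bil] scaleC_complex_def)
  note lin = clinear_compose[OF clinear_triple_pairing clinear_tensor_assoc]
  show ?thesis
  proof (rule tensor_ext[where t = t])
    fix f u
    show "triple_pairing a \<alpha> b \<beta> c \<gamma> (tensor_assoc (f \<otimes> u))
        = tensor_lift (\<lambda>f u. poly (f a) \<alpha> * point_pairing b \<beta> c \<gamma> u) (f \<otimes> u)"
      unfolding pure
    proof (rule tensor_ext[where t = u])
      fix g h
      show "triple_pairing a \<alpha> b \<beta> c \<gamma> (tensor_assoc (f \<otimes> g \<otimes> h))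
          = poly (f a) \<alpha> *\<^sub>C point_pairing b \<beta> c \<gamma> (g \<otimes> h)"
        by (simp add: tensor_assoc_pure scaleC_complex_def)
    qed (rule clinear_compose[OF lin cbilinearD(1)[OF pure_tensor_bilinear]]
        clinear_mult[OF clinear_point_pairing])+
  qed (rule lin tensor_lift_clinear[OF bil])+
qed

text \<open>A coproduct is linear only on its submodule. A globally linear map with the same values
  there makes \<open>f \<otimes> \<delta> g\<close> bilinear everywhere, as
  \<open>tensor_lift_on_eq\<close> requires.\<close>

lemma clinear_extension:
  fixes f :: "'a::complex_vector \<Rightarrow> 'b::complex_vector"
  assumes V: "cv.subspace V" and add: "\<And>x y. x \<in> V \<Longrightarrow> y \<in> V \<Longrightarrow> f (x + y) = f x + f y"
    and scale: "\<And>c x. x \<in> V \<Longrightarrow> f (c *\<^sub>C x) = c *\<^sub>C f x"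
  shows "\<exists>g. clinear g \<and> (\<forall>x\<in>V. g x = f x)"
proof -
  interpret vector_space_pair "scaleC :: complex \<Rightarrow> 'a \<Rightarrow> 'a" "scaleC :: complex \<Rightarrow> 'b \<Rightarrow> 'b"
    by unfold_locales
  obtain B where B: "B \<subseteq> V" "cv.independent B" "V \<subseteq> cv.span B"
    by (rule cv.maximal_independent_subset)
  obtain g where g: "clinear g" "\<forall>x\<in>B. g x = f x"
    using linear_independent_extend[OF B(2)] by blast
  have f0: "f 0 = 0" using scale[of 0 0] cv.subspace_0[OF V] by simp
  \<comment> \<open>Membership in \<open>V\<close> is part of the induction claim because
    \<open>add\<close> and \<open>scale\<close> apply only there.\<close>
  have "x \<in> V \<and> g x = f x" if "x \<in> cv.span B" for x
    using that
  proof (induction rule: cv.span_induct_alt)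
    case base
    show ?case using V g by (simp add: cv.subspace_0 clinear_0 f0)
  next
    case (step c x y)
    then have "x \<in> V" using B(1) by blast
    then show ?case
      using step V g(2) by (simp add: cv.subspace_add cv.subspace_scale add scale clinear_add[OF g(1)]
          clinear_scale[OF g(1)])
  qed
  then show ?thesis using B(3) g(1) by blast
qed

context dmodule
begin

lemma cv_subspace: "subspace V \<Longrightarrow> cv.subspace V"
  unfolding cv.subspace_def using subspace_0 subspace_add subspace_scale[of V _ "[:_:]"]
  by (auto simp: smul_const)

lemma cbilinear_tensor_der: "cbilinear (\<lambda>u v. der u \<otimes> v + u \<otimes> der v)"
  unfolding cbilinear_def
  by (intro conjI allI clinearI)
    (simp_all add: pure_tensor_simps clinear_add[OF clinear_smul] clinear_scale[OF clinear_smul]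
      scaleC_add_right)

lemma clinear_tensor_der: "clinear tensor_der"
  unfolding tensor_der_def by (rule tensor_lift_clinear[OF cbilinear_tensor_der])

lemma tensor_der_pure: "tensor_der (u \<otimes> v) = der u \<otimes> v + u \<otimes> der v"
  unfolding tensor_der_def by (rule tensor_lift_pure[OF cbilinear_tensor_der])

lemma tensor_smul_closed:
  assumes V: "subspace V" and t: "t \<in> tensor_sub V V"
  shows "tensor_smul p t \<in> tensor_sub V V"
proof -
  have der: "tensor_der s \<in> tensor_sub V V" if "s \<in> tensor_sub V V" for s
    by (rule clinear_image_tensor_sub[OF clinear_tensor_der _ tensor_sub_subspace that])
      (simp add: tensor_der_pure cv.subspace_add tensor_sub_subspace pure_in_tensor_sub
        subspace_scale[OF V])
  have "(tensor_der ^^ n) t \<in> tensor_sub V V" for n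
    by (induction n) (simp_all add: t der)
  then show ?thesis
    unfolding tensor_smul_def
    by (intro cv.subspace_sum cv.subspace_scale tensor_sub_subspace)
qed

text \<open>The definition covers only the derivation; \<open>pCons c p\<close> acts as
  \<open>c\<close> plus the derivation after \<open>p\<close>, which reaches all
  polynomials.\<close>

lemma conf_dual_smul_right:
  assumes "f \<in> conf_dual" shows "f (smul p u) = p * f u"
proof (induction p)
  case 0
  show ?case using assms by (simp add: conf_dual_def clinear_0)
next
  case (pCons c p)
  have "smul (pCons c p) u = c *\<^sub>C u + der (smul p u)"
    using scale_left_distrib[of "[:c:]" "[:0, 1:] * p" u] by (simp add: smul_const)
  moreover have "f (der (smul p u)) = [:0, 1:] * f (smul p u)"
    using assms by (simp add: conf_dual_def del: scale_scale)
  ultimately show ?case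
    using assms pCons(2)
    by (simp add: conf_dual_def clinear_add clinear_scale scaleC_complex_poly
        del: scale_scale)
qed

lemma conf_dual_subst:
  assumes "f \<in> conf_dual" "degree Z \<le> N"
  shows "f (subst q Z) = (\<Sum>n\<le>N. q ^ n * f (coeff Z n))"
proof -
  have "clinear f" using assms(1) by (simp add: conf_dual_def)
  then show ?thesis
    by (simp add: subst_superset[OF assms(2)] clinear_sum conf_dual_smul_right[OF assms(1)])
qed

lemma subspace_conf_dual: "conf_dual.subspace conf_dual"
proof -
  have "conf_dual_smul p f \<in> conf_dual" if "f \<in> conf_dual" for p and f :: "'a \<Rightarrow> complex poly"
    unfolding conf_dual_def
  proof (intro CollectI conjI clinearI allI)
    fix c u v
    have f: "clinear f" "f (der u) = [:0, 1:] * f u" using that by (simp_all add: conf_dual_def)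
    show "conf_dual_smul p f (u + v) = conf_dual_smul p f u + conf_dual_smul p f v"
      by (simp add: conf_dual_smul_apply clinear_add[OF f(1)] distrib_left)
    show "conf_dual_smul p f (c *\<^sub>C u) = c *\<^sub>C conf_dual_smul p f u"
      by (simp add: conf_dual_smul_apply clinear_scale[OF f(1)] scaleC_complex_poly)
    show "conf_dual_smul p f (der u) = [:0, 1:] * conf_dual_smul p f u"
      by (simp add: conf_dual_smul_apply f(2))
  qed
  moreover have "0 \<in> conf_dual" by (auto simp: conf_dual_def intro!: clinearI)
  moreover have "f + g \<in> conf_dual" if "f \<in> conf_dual" "g \<in> conf_dual" for f g
    using that by (auto simp: conf_dual_def distrib_left intro!: clinearI
        simp: clinear_add clinear_scale scaleC_add_right)
  ultimately show ?thesis by (simp add: conf_dual.subspace_def)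
qed

end

text \<open>On the dual, \<partial> multiplies values by -\<lambda>, so by the Leibniz rule it acts
  on a pairing at \<alpha> and \<beta> as the number -(\<alpha> + \<beta>).\<close>

lemma point_pairing_tensor_smul:
  "point_pairing a \<alpha> b \<beta> (conf_dual.tensor_smul p t)
     = poly p (- (\<alpha> + \<beta>)) * point_pairing a \<alpha> b \<beta> t"
proof -
  have der: "point_pairing a \<alpha> b \<beta> (conf_dual.tensor_der t)
      = (- (\<alpha> + \<beta>)) *\<^sub>C point_pairing a \<alpha> b \<beta> t" for t
  proof (rule tensor_ext[where t = t])
    fix f g
    show "point_pairing a \<alpha> b \<beta> (conf_dual.tensor_der (f \<otimes> g))
        = (- (\<alpha> + \<beta>)) *\<^sub>C point_pairing a \<alpha> b \<beta> (f \<otimes> g)"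
      by (simp add: conf_dual.tensor_der_pure clinear_add[OF clinear_point_pairing]
          conf_dual_smul_apply pcompose_pCons scaleC_complex_def algebra_simps)
  qed (rule clinear_compose[OF clinear_point_pairing conf_dual.clinear_tensor_der]
      clinear_mult[OF clinear_point_pairing])+
  have "point_pairing a \<alpha> b \<beta> ((conf_dual.tensor_der ^^ n) t)
      = (- (\<alpha> + \<beta>)) ^ n * point_pairing a \<alpha> b \<beta> t" for n
    by (induction n) (simp_all add: der scaleC_complex_def)
  then show ?thesis
    by (simp add: conf_dual.tensor_smul_def clinear_sum[OF clinear_point_pairing]
        clinear_scale[OF clinear_point_pairing] scaleC_complex_def poly_altdef sum_distrib_right
        mult.assoc)
qed


section \<open>Good submodules over a Lie conformal algebra\<close>

context lie_conformal_algebra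
begin

text \<open>The change of parameters \<open>\<alpha> = -m\<close>, \<open>\<beta> = l + m\<close> is
  invertible and decouples the two evaluation points.\<close>

lemma coproduct_of_iff:
  "coproduct_of f t \<longleftrightarrow>
    (\<forall>a \<alpha> b \<beta>. point_pairing a \<alpha> b \<beta> t = poly (f (val (-\<alpha>) (br a b))) (\<alpha> + \<beta>))"
proof
  assume *: "coproduct_of f t"
  show "\<forall>a \<alpha> b \<beta>. point_pairing a \<alpha> b \<beta> t = poly (f (val (-\<alpha>) (br a b))) (\<alpha> + \<beta>)"
  proof (intro allI)
    fix a \<alpha> b \<beta>
    show "point_pairing a \<alpha> b \<beta> t = poly (f (val (-\<alpha>) (br a b))) (\<alpha> + \<beta>)"
      using *[unfolded coproduct_of_def, rule_format, of "-\<alpha>" a b "\<alpha> + \<beta>"]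
      by (simp add: point_pairing_def)
  qed
next
  assume "\<forall>a \<alpha> b \<beta>. point_pairing a \<alpha> b \<beta> t = poly (f (val (-\<alpha>) (br a b))) (\<alpha> + \<beta>)"
  then show "coproduct_of f t"
    unfolding coproduct_of_def by (simp flip: point_pairing_def)
qed

lemma coproduct_of_unique: "coproduct_of f t \<Longrightarrow> coproduct_of f t' \<Longrightarrow> t = t'"
  unfolding coproduct_of_iff
  by (rule eq_iff_diff_eq_0[THEN iffD2], rule point_pairing_separating)
    (simp add: clinear_diff[OF clinear_point_pairing])

lemma coproduct_of_add: "coproduct_of f t \<Longrightarrow> coproduct_of g s \<Longrightarrow> coproduct_of (f + g) (t + s)"
  by (simp add: coproduct_of_iff clinear_add[OF clinear_point_pairing])

lemma coproduct_of_smul: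
  "coproduct_of f t \<Longrightarrow> coproduct_of (conf_dual_smul p f) (conf_dual.tensor_smul p t)"
  by (simp add: coproduct_of_iff point_pairing_tensor_smul conf_dual_smul_apply poly_pcompose)

lemma coproduct_of_0: "coproduct_of 0 0"
  by (simp add: coproduct_of_iff clinear_0[OF clinear_point_pairing])

text \<open>Goodness can be checked on generators, because coproducts are additive and compatible
  with the polynomial action. The generators will be the elements of all good submodules, or
  coordinate functionals.\<close>

lemma good_span:
  assumes sub: "S \<subseteq> conf_dual"
    and ex: "\<And>f. f \<in> S \<Longrightarrow>
      \<exists>t\<in>tensor_sub (conf_dual.span S) (conf_dual.span S). coproduct_of f t"
  shows "good (conf_dual.span S)"
proof -
  let ?V = "conf_dual.span S"
  have "\<exists>t\<in>tensor_sub ?V ?V. coproduct_of f t" if "f \<in> ?V" for f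
    using that
  proof (induction rule: conf_dual.span_induct_alt)
    case base
    show ?case using coproduct_of_0 cv.subspace_0[OF tensor_sub_subspace] by blast
  next
    case (step p x y)
    then obtain s t where "s \<in> tensor_sub ?V ?V" "coproduct_of x s" "t \<in> tensor_sub ?V ?V"
      "coproduct_of y t"
      using ex by blast
    then have "conf_dual.tensor_smul p s + t \<in> tensor_sub ?V ?V"
      "coproduct_of (conf_dual_smul p x + y) (conf_dual.tensor_smul p s + t)"
      by (simp_all add: coproduct_of_add coproduct_of_smul cv.subspace_add[OF tensor_sub_subspace]
          conf_dual.tensor_smul_closed)
    then show ?case by blast
  qed
  then show ?thesis
    unfolding good_def
    using conf_dual.span_minimal[OF sub subspace_conf_dual] by (simp add: conf_dual.subspace_span)
qed

lemma goodD:
  assumes "good V"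
  shows "conf_dual.subspace V" "V \<subseteq> conf_dual"
    "f \<in> V \<Longrightarrow> \<exists>t\<in>tensor_sub V V. coproduct_of f t"
  using assms by (simp_all add: good_def)

lemma good_L0: "good L0"
proof -
  let ?S = "\<Union> {V. good V}"
  have "good (conf_dual.span ?S)"
  proof (rule good_span)
    show "?S \<subseteq> conf_dual" using goodD(2) by blast
  next
    fix f assume "f \<in> ?S"
    then obtain V where V: "good V" "f \<in> V" by blast
    from goodD(3)[OF this] obtain t where t: "t \<in> tensor_sub V V" "coproduct_of f t" ..
    have "V \<subseteq> ?S" using V(1) by blast
    then have "V \<subseteq> conf_dual.span ?S"
      using conf_dual.span_superset by (rule subset_trans)
    from this this have "t \<in> tensor_sub (conf_dual.span ?S) (conf_dual.span ?S)"
      by (rule subsetD[OF tensor_sub_mono t(1)])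
    with t(2) show "\<exists>t\<in>tensor_sub (conf_dual.span ?S) (conf_dual.span ?S). coproduct_of f t" ..
  qed
  then show ?thesis unfolding L0_def .
qed

lemma good_subset_L0: "good V \<Longrightarrow> V \<subseteq> L0"
  unfolding L0_def by (rule subset_trans[OF _ conf_dual.span_superset]) (rule Union_upper, simp)

lemma coproduct_eqI: "t \<in> tensor_sub V V \<Longrightarrow> coproduct_of f t \<Longrightarrow> coproduct V f = t"
  unfolding coproduct_def by (rule the_equality) (auto intro: coproduct_of_unique)

lemma
  assumes "good V" "f \<in> V"
  shows coproduct_closed: "coproduct V f \<in> tensor_sub V V"
    and coproduct_of_coproduct: "coproduct_of f (coproduct V f)"
proof -
  obtain t where t: "t \<in> tensor_sub V V" "coproduct_of f t"
    using goodD(3)[OF assms] by blast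
  show "coproduct V f \<in> tensor_sub V V" "coproduct_of f (coproduct V f)"
    using t by (simp_all add: coproduct_eqI[OF t])
qed

text \<open>All identities are tested on point evaluations; the co-Jacobi identity then becomes the Jacobi
  identity.\<close>

lemma differential_lie_coalgebra_good:
  assumes V: "good V"
  shows "differential_lie_coalgebra conf_dual_smul V (coproduct V)"
proof
  let ?\<delta> = "coproduct V"
  have conf: "f \<in> conf_dual" if "f \<in> V" for f
    using V that by (auto simp: good_def)
  have subV: "conf_dual.subspace V" using V by (simp add: good_def)
  note closed = coproduct_closed[OF V] and cop = coproduct_of_coproduct[OF V]
  have pairing: "point_pairing a \<alpha> b \<beta> (?\<delta> f) = poly (f (val (-\<alpha>) (br a b))) (\<alpha> + \<beta>)"
    if "f \<in> V" for f a \<alpha> b \<beta>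
    using cop[OF that] by (simp add: coproduct_of_iff)
  show "conf_dual.subspace V" by (rule subV)
  fix x assume x: "x \<in> V"
  show "?\<delta> x \<in> tensor_sub V V" by (rule closed[OF x])
  show add: "?\<delta> (x + y) = ?\<delta> x + ?\<delta> y" if x: "x \<in> V" and y: "y \<in> V" for x y
    by (intro coproduct_eqI cv.subspace_add tensor_sub_subspace closed coproduct_of_add cop x y)
  show smul: "?\<delta> (conf_dual_smul p x) = conf_dual.tensor_smul p (?\<delta> x)" if x: "x \<in> V" for p x
    by (intro coproduct_eqI conf_dual.tensor_smul_closed subV closed coproduct_of_smul cop x)
  have skew: "poly (x (val l (br b a))) m = - poly (x (val (- l - m) (br a b))) m"
    if "x \<in> V" for x l m a b
  proof -
    let ?N = "degree (br a b)"
    have lin: "clinear x" using conf[OF that] by (simp add: conf_dual_def)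
    have "x (val l (br b a)) = - x (subst [:-l, -1:] (br a b))"
      using br_skew[of l b a] clinear_diff[OF lin, of 0] by (simp add: clinear_0[OF lin])
    \<comment> \<open>A conformal functional turns \<partial> into its own variable, here evaluated
      at \<open>m\<close>, so substituting -l-\<partial> amounts to substituting the number
      -l-m.\<close>
    moreover have "poly (x (subst [:-l, -1:] (br a b))) m = poly (x (val (- l - m) (br a b))) m"
      by (simp add: conf_dual_subst[OF conf[OF that] order_refl] poly_sum)
    ultimately show ?thesis by simp
  qed
  have "point_pairing a \<alpha> b \<beta> (tensor_swap (?\<delta> x) + ?\<delta> x) = 0" for a \<alpha> b \<beta>
    by (simp add: clinear_add[OF clinear_point_pairing] point_pairing_swap pairing[OF x]
        skew[OF x, of "-\<beta>" b a] add.commute)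
  then show "tensor_swap (?\<delta> x) = - ?\<delta> x"
    using point_pairing_separating[of "tensor_swap (?\<delta> x) + ?\<delta> x"]
    by (simp add: eq_neg_iff_add_eq_0)
  obtain \<delta> where \<delta>: "clinear \<delta>" "\<And>f. f \<in> V \<Longrightarrow> \<delta> f = ?\<delta> f"
  proof -
    have "?\<delta> (c *\<^sub>C f) = c *\<^sub>C ?\<delta> f" if "f \<in> V" for f c
      using smul[OF that, of "[:c:]"]
      by (simp add: conf_dual.smul_const conf_dual.tensor_smul_def)
    then have "\<exists>g. clinear g \<and> (\<forall>f\<in>V. g f = ?\<delta> f)"
      by (intro clinear_extension conf_dual.cv_subspace subV add)
    then show thesis using that by blast
  qed
  have bil1: "cbilinear (\<lambda>f g. f \<otimes> \<delta> g)" and bil2: "cbilinear (\<lambda>f g. \<delta> f \<otimes> g)"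
    unfolding cbilinear_def
    by (auto intro!: clinearI
        simp: pure_tensor_simps clinear_add[OF \<delta>(1)] clinear_scale[OF \<delta>(1)])
  let ?t = "tensor_assoc (tensor_lift (\<lambda>f g. f \<otimes> \<delta> g) (?\<delta> x))"
    and ?s = "tensor_lift (\<lambda>f g. \<delta> f \<otimes> g) (?\<delta> x)"
  have V': "cv.subspace V" by (rule conf_dual.cv_subspace[OF subV])
  have on1: "tensor_lift_on V V (\<lambda>f g. f \<otimes> ?\<delta> g) (?\<delta> x) = tensor_lift (\<lambda>f g. f \<otimes> \<delta> g) (?\<delta> x)"
    by (rule tensor_lift_on_eq[OF bil1 _ closed[OF x] V']) (simp add: \<delta>(2))
  have on2: "tensor_lift_on V V (\<lambda>f g. ?\<delta> f \<otimes> g) (?\<delta> x) = ?s"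
    by (rule tensor_lift_on_eq[OF bil2 _ closed[OF x] V']) (simp add: \<delta>(2))
  \<comment> \<open>The inner coproduct evaluates \<open>g\<close> on the bracket of
    \<open>b\<close> and \<open>c\<close> at \<open>\<beta> + \<gamma>\<close>; the outer one then
    produces the nested bracket.\<close>
  have t: "triple_pairing a \<alpha> b \<beta> c \<gamma> ?t
      = poly (x (val (-\<alpha>) (br a (val (-\<beta>) (br b c))))) (\<alpha> + \<beta> + \<gamma>)" for a \<alpha> b \<beta> c \<gamma>
  proof -
    note bil = cbilinear_mult[OF clinear_point_eval clinear_point_pairing]
    have "triple_pairing a \<alpha> b \<beta> c \<gamma> ?t
        = point_pairing a \<alpha> (val (-\<beta>) (br b c)) (\<beta> + \<gamma>) (?\<delta> x)"
      unfolding triple_pairing_assoc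
    proof (rule tensor_sub_ext[OF _ _ _ closed[OF x]])
      fix f g assume "f \<in> V" "g \<in> V"
      then show "tensor_lift (\<lambda>f u. poly (f a) \<alpha> * point_pairing b \<beta> c \<gamma> u)
            (tensor_lift (\<lambda>f g. f \<otimes> \<delta> g) (f \<otimes> g))
          = point_pairing a \<alpha> (val (-\<beta>) (br b c)) (\<beta> + \<gamma>) (f \<otimes> g)"
        by (simp add: tensor_lift_pure[OF bil1] tensor_lift_pure[OF bil] \<delta>(2) pairing)
    qed (rule clinear_compose[OF tensor_lift_clinear[OF bil] tensor_lift_clinear[OF bil1]]
        clinear_point_pairing)+
    then show ?thesis by (simp add: pairing[OF x] add.assoc)
  qed
  \<comment> \<open>Here the inner coproduct belongs to the first factor, which is evaluated on the
    bracket of \<open>a\<close> and \<open>b\<close> at \<open>\<alpha> + \<beta>\<close>.\<close>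
  have s: "triple_pairing a \<alpha> b \<beta> c \<gamma> ?s
      = poly (x (val (-\<alpha>-\<beta>) (br (val (-\<alpha>) (br a b)) c))) (\<alpha> + \<beta> + \<gamma>)" for a \<alpha> b \<beta> c \<gamma>
  proof -
    have "triple_pairing a \<alpha> b \<beta> c \<gamma> ?s
        = point_pairing (val (-\<alpha>) (br a b)) (\<alpha> + \<beta>) c \<gamma> (?\<delta> x)"
    proof (rule tensor_sub_ext[OF _ _ _ closed[OF x]])
      fix f g assume "f \<in> V" "g \<in> V"
      then show "triple_pairing a \<alpha> b \<beta> c \<gamma> (tensor_lift (\<lambda>f g. \<delta> f \<otimes> g) (f \<otimes> g))
          = point_pairing (val (-\<alpha>) (br a b)) (\<alpha> + \<beta>) c \<gamma> (f \<otimes> g)"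
        by (simp add: tensor_lift_pure[OF bil2] \<delta>(2) pairing)
    qed (rule clinear_compose[OF clinear_triple_pairing tensor_lift_clinear[OF bil2]]
        clinear_point_pairing)+
    then show ?thesis by (simp add: pairing[OF x])
  qed
  have bil3: "cbilinear (\<lambda>u c. tensor_swap u \<otimes> c)"
    unfolding cbilinear_def
    by (auto intro!: clinearI simp: pure_tensor_simps clinear_add[OF clinear_tensor_swap]
        clinear_scale[OF clinear_tensor_swap])
  have swap: "triple_pairing a \<alpha> b \<beta> c \<gamma> (tensor_lift (\<lambda>u c. tensor_swap u \<otimes> c) t)
      = triple_pairing b \<beta> a \<alpha> c \<gamma> t" for a b c :: 'a and \<alpha> \<beta> \<gamma> t
  proof (rule tensor_ext[where t = t])
    fix u f
    show "triple_pairing a \<alpha> b \<beta> c \<gamma> (tensor_lift (\<lambda>u c. tensor_swap u \<otimes> c) (u \<otimes> f))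
        = triple_pairing b \<beta> a \<alpha> c \<gamma> (u \<otimes> f)"
      by (simp add: tensor_lift_pure[OF bil3] point_pairing_swap)
  qed (rule clinear_compose[OF clinear_triple_pairing tensor_lift_clinear[OF bil3]]
      clinear_triple_pairing)+
  \<comment> \<open>Under the pairings these are the three terms of the Jacobi identity at \<lambda>
    = -\<alpha>, \<mu> = -\<beta>; the swap exchanges the roles of \<open>a\<close> and
    \<open>b\<close>.\<close>
  have "?t - tensor_lift (\<lambda>u c. tensor_swap u \<otimes> c) ?t - ?s = 0"
  proof (rule triple_pairing_separating)
    fix a \<alpha> b \<beta> c \<gamma>
    have lin: "clinear x" using conf[OF x] by (simp add: conf_dual_def)
    show "triple_pairing a \<alpha> b \<beta> c \<gamma> (?t - tensor_lift (\<lambda>u c. tensor_swap u \<otimes> c) ?t - ?s) = 0"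
      unfolding clinear_diff[OF clinear_triple_pairing] swap t s
        br_Jacobi[of "-\<alpha>" a "-\<beta>" b c] clinear_add[OF lin]
      by (simp add: add.commute add.left_commute)
  qed
  then show "let t = tensor_assoc (tensor_lift_on V V (\<lambda>a b. a \<otimes> ?\<delta> b) (?\<delta> x))
      in t - tensor_lift (\<lambda>u c. tensor_swap u \<otimes> c) t = tensor_lift_on V V (\<lambda>a b. ?\<delta> a \<otimes> b) (?\<delta> x)"
    unfolding on1 on2 Let_def by simp
qed

section \<open>Subcoalgebras of \<open>L0\<close> as good submodules\<close>

lemma subcoalgebra_good:
  assumes "differential_lie_coalgebra.subcoalgebra conf_dual_smul L0 (coproduct L0) B"
  shows "good B"
proof -
  interpret L0: differential_lie_coalgebra conf_dual_smul L0 "coproduct L0"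
    by (rule differential_lie_coalgebra_good[OF good_L0])
  have B: "conf_dual.subspace B" "B \<subseteq> L0" "coproduct L0 ` B \<subseteq> tensor_sub B B"
    using assms by (simp_all add: L0.subcoalgebra_def)
  have "coproduct L0 f \<in> tensor_sub B B" "coproduct_of f (coproduct L0 f)" if "f \<in> B" for f
    using B(3) that coproduct_of_coproduct[OF good_L0 subsetD[OF B(2) that]] by auto
  then show ?thesis
    unfolding good_def using B(1) subset_trans[OF B(2) goodD(2)[OF good_L0]] by auto
qed

text \<open>By uniqueness the coproducts taken in \<open>B\<close> and in \<open>L0\<close> agree on
  \<open>B\<close>, so the one of \<open>L0\<close> preserves \<open>B\<close>.\<close>

lemma good_subcoalgebra:
  assumes B: "good B"
  shows "differential_lie_coalgebra.subcoalgebra conf_dual_smul L0 (coproduct L0) B"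
proof -
  interpret L0: differential_lie_coalgebra conf_dual_smul L0 "coproduct L0"
    by (rule differential_lie_coalgebra_good[OF good_L0])
  have "coproduct L0 f = coproduct B f" if "f \<in> B" for f
    using coproduct_closed[OF B that] tensor_sub_mono[OF good_subset_L0[OF B] good_subset_L0[OF B]]
    by (intro coproduct_eqI coproduct_of_coproduct[OF B that]) auto
  then show ?thesis
    using B good_subset_L0[OF B] coproduct_closed[OF B]
    by (auto simp: L0.subcoalgebra_def good_def)
qed

lemma Loc_L0_eq: "Loc_L0 = conf_dual.span (\<Union> {B. good B \<and> conf_dual.finite_rank B})"
proof -
  interpret L0: differential_lie_coalgebra conf_dual_smul L0 "coproduct L0"
    by (rule differential_lie_coalgebra_good[OF good_L0])
  show ?thesis
    unfolding Loc_L0_def L0.Loc_def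
    by (rule arg_cong[where f = conf_dual.span]) (auto dest: subcoalgebra_good good_subcoalgebra)
qed

text \<open>If \<open>B\<close> annihilates \<open>b\<close>, the second factors of all coproducts
  vanish at \<open>b\<close>; hence each \<open>f\<close> in \<open>B\<close> kills the values of
  the bracket, and so its coefficients. This makes statements on ideals available for good
  submodules.\<close>

lemma ideal_annihilator:
  assumes B: "good B"
  shows "ideal {x. \<forall>f\<in>B. f x = 0}"
proof -
  let ?I = "{x. \<forall>f\<in>B. f x = 0}"
  have conf: "f \<in> conf_dual" if "f \<in> B" for f using B that by (auto simp: good_def)
  then have lin: "clinear f" if "f \<in> B" for f using that by (auto simp: conf_dual_def)
  have "subspace ?I"
    unfolding subspace_def
    using conf by (auto simp: clinear_0[OF lin] clinear_add[OF lin] conf_dual_smul_right)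
  moreover have "f (coeff (br a b) n) = 0" if b: "b \<in> ?I" and f: "f \<in> B" for a b n f
  proof -
    let ?Z = "br a b"
    obtain t where t: "t \<in> tensor_sub B B" "coproduct_of f t"
      using B f by (auto simp: good_def)
    have "point_pairing a \<alpha> b \<beta> t = 0" for \<alpha> \<beta>
      by (rule tensor_sub_ext[OF clinear_point_pairing _ _ t(1), where g = "\<lambda>_. 0"])
        (use b in \<open>auto intro!: clinearI\<close>)
    then have "poly (f (val (-\<alpha>) ?Z)) (\<alpha> + \<beta>) = 0" for \<alpha> \<beta>
      using t(2) by (simp add: coproduct_of_iff)
    from this[of "-\<mu>" "l + \<mu>" for l \<mu>] have *: "poly (f (val \<mu> ?Z)) l = 0" for l \<mu>
      by simp
    \<comment> \<open>For a fixed evaluation point \<open>l\<close>, this is \<open>f\<close>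
      applied to the bracket as a polynomial in the bracket variable; it vanishes at every
      number.\<close>
    define P where "P l = (\<Sum>n\<le>degree ?Z. monom (poly (f (coeff ?Z n)) l) n)" for l
    have "poly (P l) \<mu> = 0" for l \<mu>
      using *[of \<mu> l]
      by (simp add: P_def conf_dual_subst[OF conf[OF f] order_refl] poly_sum poly_monom mult.commute)
    then have "P l = 0" for l using poly_all_0_iff_0[of "P l"] by blast
    then have "coeff (P l) n = 0" for l by simp
    then have "poly (f (coeff ?Z n)) l = 0" for l
      by (cases "n \<le> degree ?Z")
        (auto simp: P_def coeff_sum coeff_eq_0 clinear_0[OF lin[OF f]])
    then show ?thesis using poly_all_0_iff_0[of "f (coeff ?Z n)"] by blast
  qed
  ultimately show ?thesis by (simp add: ideal_def)
qed

end


section \<open>Linear relations over a domain\<close>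

text \<open>Fraction-free elimination of the last unknown.\<close>

lemma nontrivial_linear_relation:
  fixes p :: "'i \<Rightarrow> nat \<Rightarrow> 'a::idom"
  assumes "finite A" "n < card A"
  shows "\<exists>q. (\<exists>i\<in>A. q i \<noteq> 0) \<and> (\<forall>j<n. (\<Sum>i\<in>A. q i * p i j) = 0)"
  using assms
proof (induction n arbitrary: A p)
  case 0
  then have "A \<noteq> {}" by auto
  then show ?case by (intro exI[of _ "\<lambda>_. 1"]) auto
next
  case (Suc n)
  show ?case
  proof (cases "\<forall>i\<in>A. p i n = 0")
    case True
    obtain q where "\<exists>i\<in>A. q i \<noteq> 0" "\<forall>j<n. (\<Sum>i\<in>A. q i * p i j) = 0"
      using Suc.IH[of A p] Suc.prems by auto
    with True show ?thesis by (intro exI[of _ q]) (auto simp: less_Suc_eq)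
  next
    case False
    then obtain r where r: "r \<in> A" "p r n \<noteq> 0" by blast
    let ?p = "\<lambda>i j. p r n * p i j - p i n * p r j"
    have "n < card (A - {r})" using Suc.prems r by simp
    then obtain q where q: "\<exists>i\<in>A - {r}. q i \<noteq> 0" "\<forall>j<n. (\<Sum>i\<in>A - {r}. q i * ?p i j) = 0"
      using Suc.IH[of "A - {r}" ?p] Suc.prems(1) by blast
    \<comment> \<open>The pivot \<open>r\<close> receives the value that cancels column
      \<open>n\<close>; scaling the other unknowns by \<open>p r n\<close> avoids division.\<close>
    define q' where "q' i = (if i = r then - (\<Sum>i\<in>A - {r}. q i * p i n) else q i * p r n)" for i
    have "(\<Sum>i\<in>A. q' i * p i j) = (\<Sum>i\<in>A - {r}. q i * ?p i j)" for j
    proof -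
      have "(\<Sum>i\<in>A - {r}. q' i * p i j) = (\<Sum>i\<in>A - {r}. q i * p r n * p i j)"
        by (rule sum.cong) (auto simp: q'_def)
      moreover have "q' r * p r j = - (\<Sum>i\<in>A - {r}. q i * p i n * p r j)"
        by (simp add: q'_def sum_distrib_right)
      ultimately show ?thesis
        by (simp add: sum.remove[OF Suc.prems(1) r(1)] algebra_simps sum_subtractf)
    qed
    \<comment> \<open>In the pivot column the entries \<open>?p i n\<close> are zero, which supplies
      the last equation.\<close>
    moreover have "(\<Sum>i\<in>A - {r}. q i * ?p i n) = 0" by (simp add: mult.commute)
    ultimately have "\<forall>j<Suc n. (\<Sum>i\<in>A. q' i * p i j) = 0"
      using q(2) by (auto simp: less_Suc_eq)
    moreover have "\<exists>i\<in>A. q' i \<noteq> 0" using q(1) r(2) by (auto simp: q'_def)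
    ultimately show ?thesis by blast
  qed
qed

text \<open>Division with remainder by a nonzero element of least degree. The zero ideal gets the
  generator 0, which accounts for \<open>J 0\<close>.\<close>

lemma poly_ideal_principal:
  fixes P :: "'a::field poly set"
  assumes 0: "0 \<in> P" and add: "\<And>p q. p \<in> P \<Longrightarrow> q \<in> P \<Longrightarrow> p + q \<in> P"
    and mult: "\<And>p q. p \<in> P \<Longrightarrow> q * p \<in> P"
  shows "\<exists>a. P = {p. a dvd p}"
proof (cases "P = {0}")
  case True
  then show ?thesis by (intro exI[of _ 0]) auto
next
  case False
  then have "\<exists>p. p \<in> P \<and> p \<noteq> 0" using 0 by blast
  then obtain a where a: "a \<in> P" "a \<noteq> 0"
    and min: "\<And>p. p \<in> P \<Longrightarrow> p \<noteq> 0 \<Longrightarrow> degree a \<le> degree p"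
    using ex_has_least_nat[of "\<lambda>p. p \<in> P \<and> p \<noteq> 0" _ degree] by blast
  have "a dvd p" if p: "p \<in> P" for p
  proof -
    have "p mod a = p + (- (p div a)) * a"
      by (simp add: minus_div_mult_eq_mod[symmetric])
    then have "p mod a \<in> P" using add[OF p mult[OF a(1)]] by metis
    then have "p mod a = 0"
      using min degree_mod_less[OF a(2), of p] by (meson leD)
    then show ?thesis by (simp add: dvd_eq_mod_eq_0)
  qed
  then show ?thesis
    using mult[OF a(1)] by (intro exI[of _ a]) (auto simp: dvd_def mult.commute)
qed

context dmodule
begin

text \<open>For sums the annihilating polynomials are multiplied; the product is nonzero in a
  domain.\<close>

lemma subspace_torsion_mod:
  assumes "subspace N"
  shows "subspace (torsion_mod UNIV N)"
  unfolding subspace_def torsion_mod_def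
proof (intro conjI ballI allI CollectI UNIV_I; (elim CollectE conjE exE)?)
  show "\<exists>p. p \<noteq> 0 \<and> smul p 0 \<in> N" using subspace_0[OF assms] by (intro exI[of _ 1]) simp
  fix x p assume x: "p \<noteq> 0" "smul p x \<in> N"
  show "\<exists>r. r \<noteq> 0 \<and> smul r (smul c x) \<in> N" for c
    using x subspace_scale[OF assms x(2), of c] by (intro exI[of _ p]) (simp add: mult.commute)
  fix y q assume y: "q \<noteq> 0" "smul q y \<in> N"
  have "smul (p * q) (x + y) = smul q (smul p x) + smul p (smul q y)"
    by (simp add: scale_right_distrib mult.commute)
  also have "\<dots> \<in> N"
    by (intro subspace_add subspace_scale assms x y)
  finally show "\<exists>r. r \<noteq> 0 \<and> smul r (x + y) \<in> N" using x y by (intro exI[of _ "p * q"]) simp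
qed

end


section \<open>Coordinates on the current algebra\<close>

lemma lookup_basis_e: "Poly_Mapping.lookup (basis_e i) j = (if i = j then 1 else 0)"
  by (simp add: basis_e_def lookup_single when_def)

lemma clinear_e_star: "clinear (e_star i)"
  by (rule clinearI) (simp_all add: e_star_def lookup_add)

text \<open>No bracket has an \<open>e_0\<close> component, and for \<open>i \<ge> 1\<close> the
  vector \<open>e_i\<close> arises only from \<open>e_0\<close> and \<open>e_(i+1)\<close>. The
  right side already displays the coproduct of \<open>e_star i\<close>.\<close>

lemma e_star_g_bracket:
  "e_star i (g_bracket x y)
     = (if i = 0 then 0 else e_star 0 x * e_star (i + 1) y - e_star (i + 1) x * e_star 0 y)"
proof -
  note B = cbilinearD[OF g_bracket_bilinear]
  note M = cbilinearD[OF cbilinear_mult[OF clinear_e_star clinear_e_star]]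
  have M': "clinear (\<lambda>y. e_star (i + 1) x * e_star 0 y)"
    "clinear (\<lambda>x. e_star (i + 1) x * e_star 0 y)"
    "clinear (\<lambda>y. e_star 0 x * e_star (i + 1) y)"
    "clinear (\<lambda>x. e_star 0 x * e_star (i + 1) y)" for x y
    by (rule M)+
  have diff: "clinear (\<lambda>x. f x - h x)" if "clinear f" "clinear h" for f h :: "g_space \<Rightarrow> complex"
    using clinear_plus[OF that(1) clinear_uminus[OF that(2)]] by simp
  have zero: "clinear (\<lambda>_ :: g_space. 0 :: complex)" by (rule clinearI) simp_all
  show ?thesis
  proof (rule g_ext[where x = x])
    fix j
    show "e_star i (g_bracket (basis_e j) y) = (if i = 0 then 0
        else e_star 0 (basis_e j) * e_star (i + 1) y - e_star (i + 1) (basis_e j) * e_star 0 y)"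
    proof (rule g_ext[where x = y])
      fix k
      show "e_star i (g_bracket (basis_e j) (basis_e k)) = (if i = 0 then 0
          else e_star 0 (basis_e j) * e_star (i + 1) (basis_e k)
            - e_star (i + 1) (basis_e j) * e_star 0 (basis_e k))"
        by (auto simp: g_bracket_basis basis_bracket_def e_star_def lookup_basis_e)
    next
      show "clinear (\<lambda>y. if i = 0 then 0
          else e_star 0 (basis_e j) * e_star (i + 1) y - e_star (i + 1) (basis_e j) * e_star 0 y)"
        using zero diff[OF M'(3,1)] by (cases "i = 0") simp_all
    qed (rule clinear_compose[OF clinear_e_star B(1)])
  next
    show "clinear (\<lambda>x. if i = 0 then 0
        else e_star 0 x * e_star (i + 1) y - e_star (i + 1) x * e_star 0 y)"
      using zero diff[OF M'(4,2)] by (cases "i = 0") simp_all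
  qed (rule clinear_compose[OF clinear_e_star B(2)])
qed

lemma basis_expansion:
  "v = (\<Sum>i\<in>Poly_Mapping.keys v. Poly_Mapping.lookup v i *\<^sub>C basis_e i)"
  by (rule poly_mapping_eqI) (simp add: lookup_sum lookup_basis_e scaleC_complex_def in_keys_iff
      if_distrib cong: if_cong)

lemma span_basis_e: "cv.span (range basis_e) = UNIV"
proof -
  have "v \<in> cv.span (range basis_e)" for v
    by (subst basis_expansion) (intro cv.span_sum cv.span_scale cv.span_base rangeI)
  then show ?thesis by blast
qed

section \<open>The map \<open>theta\<close> and the coordinate functionals\<close>

lemma theta_bilinear:
  "cbilinear (\<lambda>q \<phi>. tensor_lift (\<lambda>p v. smult (\<phi> v) (pcompose q [:0, -1:] * p)) y)"
  for y :: "'v::complex_vector cur"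
  unfolding cbilinear_def
proof (intro conjI allI clinearI)
  fix q q' :: "complex poly" and \<phi> \<psi> :: "'v \<Rightarrow> complex" and c
  let ?\<beta> = "\<lambda>(q :: complex poly) \<phi>. tensor_lift (\<lambda>p v. smult (\<phi> v) (pcompose q [:0, -1:] * p)) y"
  show "?\<beta> q (\<phi> + \<psi>) = ?\<beta> q \<phi> + ?\<beta> q \<psi>"
    by (simp add: smult_add_left flip: tensor_lift_on_add)
  show "?\<beta> (q + q') \<phi> = ?\<beta> q \<phi> + ?\<beta> q' \<phi>"
    by (simp add: pcompose_add distrib_right smult_add_right flip: tensor_lift_on_add)
  show "?\<beta> q (c *\<^sub>C \<phi>) = c *\<^sub>C ?\<beta> q \<phi>"
    unfolding tensor_lift_on_scale[symmetric]
    by (simp add: scaleC_fun_def scaleC_complex_poly scaleC_complex_def)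
  show "?\<beta> (c *\<^sub>C q) \<phi> = c *\<^sub>C ?\<beta> q \<phi>"
    unfolding tensor_lift_on_scale[symmetric]
    by (simp add: scaleC_complex_poly pcompose_smult mult.commute)
qed

lemma theta_pure:
  "theta (q \<otimes> \<phi>) y = tensor_lift (\<lambda>p v. smult (\<phi> v) (pcompose q [:0, -1:] * p)) y"
  unfolding theta_def by (rule tensor_lift_pure[OF theta_bilinear])

lemma clinear_theta: "clinear theta"
  unfolding theta_def
  by (intro clinearI ext)
    (simp_all add: clinear_add[OF tensor_lift_clinear[OF theta_bilinear]]
      clinear_scale[OF tensor_lift_clinear[OF theta_bilinear]] scaleC_fun_def)

text \<open>The polynomial coefficient of \<open>e_i\<close>. Defining it through
  \<open>theta\<close> makes it at the same time the element of the conformal dual that stands for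
  \<open>e_star i\<close>.\<close>

definition coord :: "nat \<Rightarrow> g_space cur \<Rightarrow> complex poly" where
  "coord i = theta (1 \<otimes> e_star i)"

lemma coord_bilinear: "cbilinear (\<lambda>p v. smult (e_star i v) p)"
  unfolding cbilinear_def
  by (intro conjI allI clinearI)
    (simp_all add: clinear_add[OF clinear_e_star] clinear_scale[OF clinear_e_star]
      smult_add_left smult_add_right scaleC_complex_poly scaleC_complex_def mult.commute)

lemma coord_altdef: "coord i = tensor_lift (\<lambda>p v. smult (e_star i v) p)"
  by (rule ext) (simp add: coord_def theta_pure pcompose_1)

lemma clinear_coord: "clinear (coord i)"
  unfolding coord_altdef by (rule tensor_lift_clinear[OF coord_bilinear])

lemma coord_pure [simp]: "coord i (p \<otimes> v) = smult (e_star i v) p"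
  unfolding coord_altdef by (rule tensor_lift_pure[OF coord_bilinear])

lemma clinear_times: "clinear (\<lambda>x. p * f x)" if "clinear f" for p :: "complex poly"
  by (rule clinearI)
    (simp_all add: clinear_add[OF that] clinear_scale[OF that] distrib_left scaleC_complex_poly)

lemma coord_cur_smul [simp]: "coord i (cur_smul p x) = p * coord i x"
  by (rule tensor_ext[where t = x])
    (simp_all add: clinear_compose[OF clinear_coord clinear_cur_smul] clinear_times clinear_coord)

lemma coord_conf_dual: "coord i \<in> cur.conf_dual"
  by (simp add: cur.conf_dual_def clinear_coord del: mult_pCons_left)

text \<open>The substitution of -\<lambda> in \<open>theta\<close> is exactly the polynomial action
  on the dual.\<close>

lemma theta_pure_e_star: "theta (q \<otimes> e_star i) = conf_dual_smul q (coord i)"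
proof
  fix y
  have bil: "cbilinear (\<lambda>p v. smult (e_star i v) (pcompose q [:0, -1:] * p))"
    using coord_bilinear[of i] unfolding cbilinear_def
    by (auto intro!: clinear_times simp flip: mult_smult_right)
  show "theta (q \<otimes> e_star i) y = conf_dual_smul q (coord i) y"
    unfolding theta_pure conf_dual_smul_apply
    by (rule tensor_ext[where t = y])
      (simp_all add: tensor_lift_clinear[OF bil] tensor_lift_pure[OF bil] clinear_times
        clinear_coord)
qed

text \<open>The correction kills \<open>q \<otimes> e_0\<close> and fixes
  \<open>q \<otimes> e_i\<close> for \<open>i \<ge> 1\<close>. Together with
  \<open>coord_0_span\<close> this identifies the kernel of \<open>coord 0\<close> with
  \<open>K\<close>.\<close>

lemma diff_coord_0_in_span:
  "x - coord 0 x \<otimes> basis_e 0 \<in> cv.span {q \<otimes> basis_e i | q i. 1 \<le> i}"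
proof -
  obtain F u where F: "finite F" "F \<subseteq> range basis_e" "x = (\<Sum>k\<in>F. u k \<otimes> k)"
    using tensor_expansion[OF span_basis_e] by blast
  define f where "f x = x - coord 0 x \<otimes> basis_e 0" for x
  have lin: "clinear f"
    by (rule clinearI) (simp_all add: f_def clinear_add[OF clinear_coord]
        clinear_scale[OF clinear_coord] pure_tensor_simps cv.scale_right_diff_distrib)
  have "f (u k \<otimes> k) \<in> cv.span {q \<otimes> basis_e i | q i. 1 \<le> i}" if k: "k \<in> F" for k
  proof -
    obtain i where i: "k = basis_e i" using F(2) k by blast
    show ?thesis
    proof (cases "i = 0")
      case True
      then show ?thesis by (simp add: f_def i e_star_basis cv.span_zero)
    next
      case False
      then have "f (u k \<otimes> k) = u k \<otimes> basis_e i"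
        by (simp add: f_def i e_star_basis pure_tensor_simps)
      moreover have "u k \<otimes> basis_e i \<in> {q \<otimes> basis_e i | q i. 1 \<le> i}" using False by force
      ultimately show ?thesis by (simp add: cv.span_base)
    qed
  qed
  then have "f x \<in> cv.span {q \<otimes> basis_e i | q i. 1 \<le> i}"
    unfolding F(3) clinear_sum[OF lin] by (rule cv.span_sum)
  then show ?thesis by (simp add: f_def)
qed

lemma coord_0_span:
  assumes "y \<in> cv.span {q \<otimes> basis_e i | q i. 1 \<le> i}"
  shows "coord 0 y = 0"
  using assms
proof (induction rule: cv.span_induct_alt)
  case base
  show ?case by (rule clinear_0[OF clinear_coord])
next
  case (step c x y)
  then show ?case
    by (auto simp: clinear_add[OF clinear_coord] clinear_scale[OF clinear_coord] e_star_basis)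
qed

text \<open>Questions about \<open>J a\<close> become divisibility questions about a single
  polynomial.\<close>

lemma J_eq: "J a = {x. a dvd coord 0 x}"
proof
  show "J a \<subseteq> {x. a dvd coord 0 x}"
    by (auto simp: J_def clinear_add[OF clinear_coord] coord_0_span e_star_basis)
  show "{x. a dvd coord 0 x} \<subseteq> J a"
  proof
    fix x assume "x \<in> {x. a dvd coord 0 x}"
    then obtain p where "coord 0 x = a * p" by (auto simp: dvd_def)
    then have "x = (a * p) \<otimes> basis_e 0 + (x - coord 0 x \<otimes> basis_e 0)" by simp
    then show "x \<in> J a" unfolding J_def using diff_coord_0_in_span by blast
  qed
qed


section \<open>Ideals of the current algebra\<close>

lemma clinear_coeff: "clinear (\<lambda>Z. coeff Z n)"
  by (rule clinearI) simp_all

lemma coord_0_coeff_bracket: "coord 0 (coeff (cur_bracket g_bracket x y) n) = 0"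
proof -
  note B = cbilinearD[OF g.cur_bracket_bilinear]
  note lin = clinear_compose[OF clinear_coord clinear_compose[OF clinear_coeff]]
  show ?thesis
  proof (rule tensor_ext[where t = x])
    fix f a
    show "coord 0 (coeff (cur_bracket g_bracket (f \<otimes> a) y) n) = 0"
    proof (rule tensor_ext[where t = y])
      fix g b
      show "coord 0 (coeff (cur_bracket g_bracket (f \<otimes> a) (g \<otimes> b)) n) = 0"
        by (simp add: g.cur_bracket_pure coeff_map_poly pure_tensor_simps e_star_g_bracket)
    qed (rule lin B clinear_zero)+
  qed (rule lin B clinear_zero)+
qed

lemma J_ideal: "g.cur.ideal (J a)"
  unfolding g.cur.ideal_def cur.subspace_def J_eq
  by (auto simp: clinear_0[OF clinear_coord] clinear_add[OF clinear_coord] coord_0_coeff_bracket)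

text \<open>For \<open>a = 0\<close> the quotient is free on the class of \<open>e_0\<close>;
  otherwise \<open>a\<close> annihilates it, so it is torsion and no free generator is
  taken.\<close>

lemma J_cofinite_rank: "g.cur.cofinite_rank (J a)"
proof (cases "a = 0")
  case True
  let ?T = "cur.torsion_mod UNIV (J a)"
  have "x \<in> {(\<Sum>i<Suc 0. cur_smul (p i) (1 \<otimes> basis_e 0)) + t | p t. t \<in> ?T}" for x
  proof -
    have "x - coord 0 x \<otimes> basis_e 0 \<in> ?T"
      by (auto simp: cur.torsion_mod_def J_eq clinear_diff[OF clinear_coord] e_star_basis
          intro!: exI[of _ 1])
    then show ?thesis
      by (intro CollectI exI[of _ "\<lambda>_. coord 0 x"] exI[of _ "x - coord 0 x \<otimes> basis_e 0"]) simp
  qed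
  then have "UNIV = {(\<Sum>i<Suc 0. cur_smul (p i) (1 \<otimes> basis_e 0)) + t | p t. t \<in> ?T}"
    by blast
  then show ?thesis
    unfolding g.cur.cofinite_rank_def cur.finite_rank_mod_def
    by (intro exI[of _ "Suc 0"] exI[of _ "\<lambda>_. 1 \<otimes> basis_e 0"])
      (simp add: J_eq True e_star_basis)
next
  case False
  then have "cur.torsion_mod UNIV (J a) = UNIV"
    by (auto simp: cur.torsion_mod_def J_eq)
  then show ?thesis
    unfolding g.cur.cofinite_rank_def cur.finite_rank_mod_def
    by (intro exI[of _ "0 :: nat"]) simp
qed

lemma J_nontrivial:
  assumes "\<not> (\<exists>c. c \<noteq> 0 \<and> a = [:c:])"
  shows "J a \<noteq> {0}" "J a \<noteq> UNIV"
proof -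
  have "1 \<otimes> basis_e 1 \<in> J a" by (simp add: J_eq e_star_basis)
  moreover have "1 \<otimes> basis_e 1 \<noteq> (0 :: g_space cur)"
  proof
    assume "1 \<otimes> basis_e 1 = (0 :: g_space cur)"
    then have "coord 1 (1 \<otimes> basis_e 1) = 0" by (simp add: clinear_0[OF clinear_coord])
    then show False by (simp add: e_star_basis)
  qed
  ultimately show "J a \<noteq> {0}" by blast
  have "\<not> a dvd 1"
  proof
    assume "a dvd 1"
    then obtain c where "a = [:c:]" "c dvd 1" by (rule is_unit_polyE)
    then show False using assms by (metis dvd_0_left one_neq_zero)
  qed
  then have "1 \<otimes> basis_e 0 \<notin> J a" by (simp add: J_eq e_star_basis one_pCons)
  then show "J a \<noteq> UNIV" by blast
qed

text \<open>\<open>ad e_0\<close> is the left shift of coordinates, except that it kills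
  \<open>e_1\<close> and so leaves entry 0 empty.\<close>

lemma lookup_ad_e0:
  "Poly_Mapping.lookup (((g_bracket (basis_e 0)) ^^ m) v) i
     = (if i = 0 \<and> m > 0 then 0 else Poly_Mapping.lookup v (i + m))"
proof (induction m arbitrary: i)
  case (Suc m)
  then show ?case
    using e_star_g_bracket[of i "basis_e 0" "(g_bracket (basis_e 0) ^^ m) v"]
    by (simp add: e_star_def lookup_basis_e)
qed simp

text \<open>Shifting a vector of \<open>W\<close> without low components down by \<open>ad e\<^sub>0\<close> produces a vector whose top
  component has index \<open>j\<close>.\<close>

lemma shift_invariant_subspace:
  assumes W: "cv.subspace W" and shift: "\<And>v. v \<in> W \<Longrightarrow> g_bracket (basis_e 0) v \<in> W"
    and high: "\<And>N. \<exists>v\<in>W. v \<noteq> 0 \<and> (\<forall>i<N. Poly_Mapping.lookup v i = 0)"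
    and j: "1 \<le> j"
  shows "basis_e j \<in> W"
  using j
proof (induction j rule: less_induct)
  case (less j)
  obtain v where v: "v \<in> W" "v \<noteq> 0" "\<And>i. i < j \<Longrightarrow> Poly_Mapping.lookup v i = 0"
    using high[of j] by blast
  define k where "k = Max (Poly_Mapping.keys v)"
  have "Poly_Mapping.keys v \<noteq> {}" using v(2) by simp
  then have k: "k \<in> Poly_Mapping.keys v" and top: "\<And>i. k < i \<Longrightarrow> Poly_Mapping.lookup v i = 0"
    using Max_in[of "Poly_Mapping.keys v"] Max_ge[of "Poly_Mapping.keys v"]
    by (auto simp: k_def in_keys_iff dest: leD)
  have jk: "j \<le> k" using v(3)[of k] k by (force simp: in_keys_iff not_le[symmetric])
  \<comment> \<open>These \<open>k - j\<close> shifts carry the top index \<open>k\<close> of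
    \<open>v\<close> to \<open>j\<close>.\<close>
  define w where "w = (g_bracket (basis_e 0) ^^ (k - j)) v"
  have "w \<in> W" proof -
    have "(g_bracket (basis_e 0) ^^ m) v \<in> W" for m
      by (induction m) (simp_all add: v(1) shift)
    then show ?thesis by (simp add: w_def)
  qed
  have w0: "Poly_Mapping.lookup w 0 = 0"
    using v(3)[of 0] less.prems jk by (simp add: w_def lookup_ad_e0)
  have wj: "Poly_Mapping.lookup w j \<noteq> 0"
    using k less.prems jk by (simp add: w_def lookup_ad_e0 in_keys_iff)
  have wtop: "Poly_Mapping.lookup w i = 0" if "j < i" for i
    using top[of "i + (k - j)"] that jk by (simp add: w_def lookup_ad_e0)
  \<comment> \<open>The remaining components have positive index below \<open>j\<close>, so they lie
    in \<open>W\<close> by induction and can be subtracted.\<close>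
  let ?K = "Poly_Mapping.keys w - {j}"
  have "basis_e i \<in> W" if "i \<in> ?K" for i
    using that w0 wtop[of i] less.IH[of i]
    by (cases "i = 0"; cases i j rule: linorder_cases) (auto simp: in_keys_iff)
  then have "(\<Sum>i\<in>?K. Poly_Mapping.lookup w i *\<^sub>C basis_e i) \<in> W"
    by (intro cv.subspace_sum cv.subspace_scale W) auto
  moreover have "w = Poly_Mapping.lookup w j *\<^sub>C basis_e j
      + (\<Sum>i\<in>?K. Poly_Mapping.lookup w i *\<^sub>C basis_e i)"
    using basis_expansion[of w] wj
    by (simp add: sum.remove[of "Poly_Mapping.keys w" j] in_keys_iff)
  ultimately have "Poly_Mapping.lookup w j *\<^sub>C basis_e j \<in> W"
    using \<open>w \<in> W\<close> cv.subspace_diff[OF W] by (metis add_diff_cancel_right')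
  from cv.subspace_scale[OF W this, of "inverse (Poly_Mapping.lookup w j)"] wj
  show ?case by (simp add: scaleC_scaleC scaleC_one)
qed

lemma cur_coeff_1_pCons:
  "cur_coeff 1 (pCons c q) = [:[:c:]:] + [:[:0, 1:], 1:] * cur_coeff 1 q"
  by (simp add: cur_coeff_def pcompose_1 map_poly_pCons pcompose_pCons)

text \<open>\<open>cur_coeff 1 q\<close> is q(\<lambda> + \<partial>), whose top coefficient in
  \<lambda> is free of \<partial>. Allowing \<open>d\<close> above the degree, where both sides are
  zero, lets one \<open>d\<close> serve several polynomials.\<close>

lemma coeff_cur_coeff_1: "degree q \<le> d \<Longrightarrow> coeff (cur_coeff 1 q) d = [:coeff q d:]"
proof (induction q arbitrary: d)
  case 0
  show ?case by (simp add: cur_coeff_def)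
next
  case (pCons c q)
  show ?case
  proof (cases d)
    case 0
    with pCons.prems have "q = 0" by (simp split: if_splits)
    then show ?thesis by (simp add: cur_coeff_1_pCons 0) (simp add: cur_coeff_def)
  next
    case (Suc d')
    with pCons.prems have "degree q \<le> d'" by (simp split: if_splits)
    then show ?thesis
      using pCons.IH[of d'] pCons.IH[of "Suc d'"]
      by (simp add: cur_coeff_1_pCons Suc coeff_pCons coeff_eq_0 split: nat.splits)
  qed
qed

text \<open>The top coefficient in \<open>\<lambda>\<close> of the bracket of \<open>e\<^sub>0\<close> with an element of the ideal is constant in
  \<open>\<partial>\<close>, which reduces the claim to the subspace of all \<open>v\<close> with \<open>1 \<otimes> v\<close> in the ideal.\<close>

lemma ideal_contains_span:
  assumes I: "g.cur.ideal I"
    and high: "\<And>N. \<exists>A q. finite A \<and> A \<subseteq> {N..} \<and> (\<exists>i\<in>A. q i \<noteq> 0) \<and>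
      (\<Sum>i\<in>A. q i \<otimes> basis_e i) \<in> I"
    and x: "coord 0 x = 0"
  shows "x \<in> I"
proof -
  have sub: "cur.subspace I" and br: "\<And>a b n. b \<in> I \<Longrightarrow> coeff (cur_bracket g_bracket a b) n \<in> I"
    using I by (auto simp: g.cur.ideal_def)
  have sub': "cv.subspace I" by (rule cur.cv_subspace[OF sub])
  have top: "coeff (cur_bracket g_bracket (1 \<otimes> basis_e 0) (q \<otimes> v)) d
      = 1 \<otimes> g_bracket (basis_e 0) (coeff q d *\<^sub>C v)" if "degree q \<le> d" for q v d
  proof -
    have "[:c:] \<otimes> w = c *\<^sub>C (1 \<otimes> w)" for c and w :: g_space
      using pure_tensor_simps(4)[of c "1 :: complex poly" w] by (simp add: scaleC_complex_poly)
    then show ?thesis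
      by (simp add: g.cur_bracket_pure coeff_map_poly pure_tensor_simps coeff_cur_coeff_1[OF that]
          g.lb_simps)
  qed
  define W where "W = {v. (1 :: complex poly) \<otimes> v \<in> I}"
  have W: "cv.subspace W"
    using sub' by (simp add: cv.subspace_def W_def pure_tensor_simps)
  have shift: "g_bracket (basis_e 0) v \<in> W" if "v \<in> W" for v
    using br[of "1 \<otimes> v" "1 \<otimes> basis_e 0" 0] that by (simp add: W_def top scaleC_one)
  have W_high: "\<exists>v\<in>W. v \<noteq> 0 \<and> (\<forall>i<N. Poly_Mapping.lookup v i = 0)" for N
  proof -
    \<comment> \<open>Bracketing with \<open>e_0\<close> lowers indices by one, and the index
      \<open>r - 1\<close> used below must still be positive, even for \<open>N = 0\<close>.\<close>
    obtain A q where A: "finite A" "A \<subseteq> {Suc (Suc N)..}" "\<exists>i\<in>A. q i \<noteq> 0"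
      and mem: "(\<Sum>i\<in>A. q i \<otimes> basis_e i) \<in> I"
      using high by metis
    \<comment> \<open>The largest degree that occurs: at this power of \<lambda> every summand
      contributes a constant in \<partial>, and the one at \<open>r\<close> is nonzero.\<close>
    define d where "d = Max ((\<lambda>i. degree (q i)) ` {i\<in>A. q i \<noteq> 0})"
    have "d \<in> (\<lambda>i. degree (q i)) ` {i\<in>A. q i \<noteq> 0}"
      unfolding d_def using A by (intro Max_in) auto
    then obtain r where r: "r \<in> A" "coeff (q r) d \<noteq> 0" by auto
    have deg: "degree (q i) \<le> d" if "i \<in> A" for i
      using that A(1) by (cases "q i = 0") (auto simp: d_def)
    define w where "w = (\<Sum>i\<in>A. coeff (q i) d *\<^sub>C basis_e i)"
    define v where "v = g_bracket (basis_e 0) w"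
    have w: "Poly_Mapping.lookup w i = (if i \<in> A then coeff (q i) d else 0)" for i
      using A(1) by (simp add: w_def lookup_sum lookup_basis_e scaleC_complex_def if_distrib
          cong: if_cong)
    have v: "Poly_Mapping.lookup v i = (if i = 0 then 0 else Poly_Mapping.lookup w (Suc i))" for i
      using lookup_ad_e0[of 1 w i] by (simp add: v_def)
    have "coeff (cur_bracket g_bracket (1 \<otimes> basis_e 0) (\<Sum>i\<in>A. q i \<otimes> basis_e i)) d
        = (\<Sum>i\<in>A. 1 \<otimes> g_bracket (basis_e 0) (coeff (q i) d *\<^sub>C basis_e i))"
      by (simp add: clinear_sum[OF cbilinearD(1)[OF g.cur_bracket_bilinear]]
          clinear_sum[OF clinear_coeff] top deg)
    also have "\<dots> = 1 \<otimes> v"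
      by (simp add: v_def w_def clinear_sum[OF cbilinearD(1)[OF g_bracket_bilinear]]
          clinear_sum[OF cbilinearD(1)[OF pure_tensor_bilinear]])
    finally have "v \<in> W" using br[OF mem] by (metis W_def mem_Collect_eq)
    moreover have "Poly_Mapping.lookup v (r - 1) \<noteq> 0"
      using r A(2) by (auto simp: v w)
    moreover have "Poly_Mapping.lookup v i = 0" if "i < N" for i
      using A(2) that by (auto simp: v w)
    ultimately show ?thesis by (metis lookup_zero)
  qed
  have "q \<otimes> basis_e j \<in> I" if "1 \<le> j" for q j
  proof -
    have "1 \<otimes> basis_e j \<in> I"
      using shift_invariant_subspace[OF W shift W_high that] by (simp add: W_def)
    from cur.subspace_scale[OF sub this, of q] show ?thesis by simp
  qed
  then have "cv.span {q \<otimes> basis_e i | q i. 1 \<le> i} \<subseteq> I"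
    by (intro cv.span_minimal sub') auto
  moreover have "x \<in> cv.span {q \<otimes> basis_e i | q i. 1 \<le> i}"
    using diff_coord_0_in_span[of x] x by (simp add: pure_tensor_simps)
  ultimately show ?thesis by blast
qed

text \<open>Modulo torsion all \<open>e_i\<close> are combinations of \<open>n\<close> generators,
  so \<open>n + 1\<close> of them satisfy a nontrivial relation; a further nonzero multiple clears
  the torsion and puts the combination into \<open>I\<close>.\<close>

lemma cofinite_ideal_contains_span:
  assumes I: "g.cur.ideal I" and fin: "g.cur.cofinite_rank I" and x: "coord 0 x = 0"
  shows "x \<in> I"
proof (rule ideal_contains_span[OF I _ x])
  fix N
  let ?T = "cur.torsion_mod UNIV I"
  have sub: "cur.subspace I" using I by (simp add: g.cur.ideal_def)
  have T: "cur.subspace ?T" by (rule cur.subspace_torsion_mod[OF sub])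
  obtain n and a :: "nat \<Rightarrow> g_space cur"
    where "UNIV = {(\<Sum>i<n. cur_smul (p i) (a i)) + t | p t. t \<in> ?T}"
    using fin unfolding g.cur.cofinite_rank_def cur.finite_rank_mod_def by blast
  then have "\<exists>p t. t \<in> ?T \<and> 1 \<otimes> basis_e i = (\<Sum>j<n. cur_smul (p j) (a j)) + t" for i
    by blast
  then obtain p t where t: "\<And>i. t i \<in> ?T"
    and e: "\<And>i. 1 \<otimes> basis_e i = (\<Sum>j<n. cur_smul (p i j) (a j)) + t i"
    by metis
  \<comment> \<open>Exactly \<open>n + 1\<close> indices, one more than there are equations.\<close>
  let ?A = "{N..N + n}"
  obtain q where q: "\<exists>i\<in>?A. q i \<noteq> 0" "\<forall>j<n. (\<Sum>i\<in>?A. q i * p i j) = 0"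
    using nontrivial_linear_relation[of ?A n p] by auto
  have "(\<Sum>i\<in>?A. q i \<otimes> basis_e i)
      = (\<Sum>i\<in>?A. \<Sum>j<n. cur_smul (q i * p i j) (a j)) + (\<Sum>i\<in>?A. cur_smul (q i) (t i))"
  proof -
    have "q i \<otimes> basis_e i = (\<Sum>j<n. cur_smul (q i * p i j) (a j)) + cur_smul (q i) (t i)" for i
      using arg_cong[OF e[of i], of "cur_smul (q i)"]
      by (simp add: cur.scale_right_distrib cur.scale_sum_right)
    then show ?thesis by (simp add: sum.distrib)
  qed
  also have "(\<Sum>i\<in>?A. \<Sum>j<n. cur_smul (q i * p i j) (a j))
      = (\<Sum>j<n. cur_smul (\<Sum>i\<in>?A. q i * p i j) (a j))"
    by (subst sum.swap) (simp add: cur.scale_sum_left)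
  also have "\<dots> = 0" using q(2) by simp
  finally have "(\<Sum>i\<in>?A. q i \<otimes> basis_e i) \<in> ?T"
    using t T by (simp add: cur.subspace_sum cur.subspace_scale)
  then obtain r where r: "r \<noteq> 0" "cur_smul r (\<Sum>i\<in>?A. q i \<otimes> basis_e i) \<in> I"
    by (auto simp: cur.torsion_mod_def)
  then have "(\<Sum>i\<in>?A. (r * q i) \<otimes> basis_e i) \<in> I"
    by (simp add: cur.scale_sum_right)
  moreover have "\<exists>i\<in>?A. r * q i \<noteq> 0" using q(1) r(1) by auto
  ultimately show "\<exists>A q. finite A \<and> A \<subseteq> {N..} \<and> (\<exists>i\<in>A. q i \<noteq> 0) \<and>
      (\<Sum>i\<in>A. q i \<otimes> basis_e i) \<in> I"
    by (intro exI[of _ ?A] exI[of _ "\<lambda>i. r * q i"]) auto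
qed

text \<open>Since \<open>I\<close> contains \<open>K\<close>, it is determined by the coefficients
  at \<open>e_0\<close>, which form a principal ideal of polynomials.\<close>

lemma cofinite_ideal_eq_J:
  assumes I: "g.cur.ideal I" and fin: "g.cur.cofinite_rank I"
  shows "\<exists>a. I = J a"
proof -
  have sub: "cur.subspace I" using I by (simp add: g.cur.ideal_def)
  have "\<exists>a. {p. p \<otimes> basis_e 0 \<in> I} = {p. a dvd p}"
  proof (rule poly_ideal_principal)
    show "q * p \<in> {p. p \<otimes> basis_e 0 \<in> I}" if "p \<in> {p. p \<otimes> basis_e 0 \<in> I}" for p q
      using cur.subspace_scale[OF sub, of "p \<otimes> basis_e 0" q] that by simp
  qed (use cur.subspace_0[OF sub] cur.subspace_add[OF sub] in \<open>simp_all add: pure_tensor_simps\<close>)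
  then obtain a where a: "\<And>p. p \<otimes> basis_e 0 \<in> I \<longleftrightarrow> a dvd p" by blast
  have "x \<in> I \<longleftrightarrow> a dvd coord 0 x" for x
  proof -
    have "x - coord 0 x \<otimes> basis_e 0 \<in> I"
      by (rule cofinite_ideal_contains_span[OF I fin])
        (simp add: clinear_diff[OF clinear_coord] e_star_basis)
    then have "x \<in> I \<longleftrightarrow> coord 0 x \<otimes> basis_e 0 \<in> I"
      using cur.subspace_diff[OF sub] cur.subspace_add[OF sub]
      by (metis add_diff_cancel_left' diff_add_cancel)
    then show ?thesis by (simp add: a)
  qed
  then have "I = J a" by (auto simp: J_eq)
  then show ?thesis ..
qed

lemma nontrivial_cofinite_ideals:
  "{I. g.cur.ideal I \<and> g.cur.cofinite_rank I \<and> I \<noteq> {0} \<and> I \<noteq> UNIV}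
     = {J a | a. \<not> (\<exists>c. c \<noteq> 0 \<and> a = [:c:])}"
proof (intro equalityI subsetI)
  fix I assume "I \<in> {I. g.cur.ideal I \<and> g.cur.cofinite_rank I \<and> I \<noteq> {0} \<and> I \<noteq> UNIV}"
  then obtain a where a: "I = J a" "I \<noteq> UNIV"
    using cofinite_ideal_eq_J by blast
  \<comment> \<open>Properness of \<open>I\<close> thereby excludes nonzero constants.\<close>
  have "J [:c:] = UNIV" if "c \<noteq> 0" for c
    using that by (simp add: J_eq is_unit_pCons_iff unit_imp_dvd)
  then show "I \<in> {J a | a. \<not> (\<exists>c. c \<noteq> 0 \<and> a = [:c:])}" using a by blast
qed (use J_ideal J_cofinite_rank J_nontrivial in blast)


section \<open>The local part of the dual coalgebra\<close>

text \<open>The conformal counterpart of \<open>e_star_g_bracket\<close>; the points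
  \<open>-m\<close> and \<open>l + m\<close> are those in the definition of
  \<open>coproduct_of\<close>.\<close>

lemma coord_val_bracket:
  "poly (coord i (cur.val m (cur_bracket g_bracket x y))) l
     = (if i = 0 then 0 else poly (coord 0 x) (-m) * poly (coord (i + 1) y) (l + m)
         - poly (coord (i + 1) x) (-m) * poly (coord 0 y) (l + m))"
proof -
  note B = cbilinearD[OF g.cur_bracket_bilinear]
  have pev: "clinear (\<lambda>p. poly p c)" for c :: complex
    by (rule clinearI) (simp_all add: scaleC_complex_poly scaleC_complex_def)
  note C = clinear_compose[OF pev clinear_coord]
  note L = clinear_compose[OF C clinear_compose[OF cur.clinear_subst]]
  note M = cbilinearD[OF cbilinear_mult[OF C C]]
  have M': "clinear (\<lambda>y. poly (coord j x) c * poly (coord k y) d)"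
    "clinear (\<lambda>x. poly (coord j x) c * poly (coord k y) d)" for j k c d x y
    by (rule M)+
  have diff: "clinear (\<lambda>x. f x - h x)" if "clinear f" "clinear h"
    for f h :: "g_space cur \<Rightarrow> complex"
    using clinear_plus[OF that(1) clinear_uminus[OF that(2)]] by simp
  have cond: "clinear (\<lambda>x. if i = 0 then 0 else f x)" if "clinear f"
    for f :: "g_space cur \<Rightarrow> complex"
    using that clinear_zero by (cases "i = 0") simp_all
  show ?thesis
  proof (rule tensor_ext[where t = x])
    fix f a
    show "poly (coord i (cur.val m (cur_bracket g_bracket (f \<otimes> a) y))) l
        = (if i = 0 then 0 else poly (coord 0 (f \<otimes> a)) (-m) * poly (coord (i + 1) y) (l + m)
            - poly (coord (i + 1) (f \<otimes> a)) (-m) * poly (coord 0 y) (l + m))"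
    proof (rule tensor_ext[where t = y])
      fix g b
      show "poly (coord i (cur.val m (cur_bracket g_bracket (f \<otimes> a) (g \<otimes> b)))) l
          = (if i = 0 then 0
             else poly (coord 0 (f \<otimes> a)) (-m) * poly (coord (i + 1) (g \<otimes> b)) (l + m)
               - poly (coord (i + 1) (f \<otimes> a)) (-m) * poly (coord 0 (g \<otimes> b)) (l + m))"
        by (simp add: g.subst_cur_bracket_pure e_star_g_bracket poly_pcompose algebra_simps)
    qed (rule L B cond diff M')+
  qed (rule L B cond diff M')+
qed

lemma coproduct_of_coord:
  "g.cur.coproduct_of (coord i)
     (if i = 0 then 0 else coord 0 \<otimes> coord (i + 1) - coord (i + 1) \<otimes> coord 0)"
  by (simp add: g.cur.coproduct_of_iff coord_val_bracket clinear_diff[OF clinear_point_pairing]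
      clinear_0[OF clinear_point_pairing])

text \<open>The generator has coproduct 0, which lies in every tensor square.\<close>

lemma good_coord_0: "g.cur.good (conf_dual.span {coord 0})"
  by (rule g.cur.good_span)
    (use coproduct_of_coord[of 0] cv.subspace_0[OF tensor_sub_subspace] in
      \<open>auto simp: coord_conf_dual\<close>)

lemma good_coords: "g.cur.good (conf_dual.span (range coord))"
proof (rule g.cur.good_span)
  let ?V = "conf_dual.span (range coord)"
  have mem: "coord i \<otimes> coord j \<in> tensor_sub ?V ?V" for i j
    by (intro pure_in_tensor_sub conf_dual.span_base rangeI)
  show "\<exists>t\<in>tensor_sub ?V ?V. g.cur.coproduct_of f t" if f: "f \<in> range coord" for f
  proof -
    obtain i where i: "f = coord i" using f by blast
    show ?thesis
      unfolding i using coproduct_of_coord[of i] mem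
      by (intro bexI[of _ "if i = 0 then 0
            else coord 0 \<otimes> coord (i + 1) - coord (i + 1) \<otimes> coord 0"])
        (simp_all add: cv.subspace_diff[OF tensor_sub_subspace]
          cv.subspace_0[OF tensor_sub_subspace])
  qed
qed (auto simp: coord_conf_dual)

text \<open>Evaluation at \<open>1 \<otimes> e_0\<close> shows that \<open>coord 0\<close> generates
  a free module, whose torsion is zero.\<close>

lemma finite_rank_coord_0: "conf_dual.finite_rank (conf_dual.span {coord 0})"
proof -
  let ?E = "conf_dual.span {coord 0}"
  have zero: "p = 0" if "conf_dual_smul p (coord 0) = 0" for p
  proof -
    have "conf_dual_smul p (coord 0) (1 \<otimes> basis_e 0) = 0" using that by simp
    then have "pcompose p [:0, -1:] = 0"
      by (simp add: conf_dual_smul_apply e_star_basis)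
    then show ?thesis by (simp add: pcompose_eq_0_iff)
  qed
  have torsion: "conf_dual.torsion_mod ?E {0} = {0}"
  proof (intro equalityI subsetI)
    fix f assume "f \<in> conf_dual.torsion_mod ?E {0}"
    then obtain p r where p: "p \<noteq> 0" "conf_dual_smul p f = 0" and f: "f = conf_dual_smul r (coord 0)"
      by (auto simp: conf_dual.torsion_mod_def conf_dual.span_singleton)
    then have "p * r = 0" using zero[of "p * r"] by simp
    then show "f \<in> {0}" using p(1) f by simp
  qed (auto simp: conf_dual.torsion_mod_def conf_dual.span_zero intro!: exI[of _ 1])
  have "?E = {\<Sum>i<Suc 0. conf_dual_smul (p i) (coord 0) | p. True}"
    by (auto simp: conf_dual.span_singleton)
  then show ?thesis
    unfolding conf_dual.finite_rank_mod_def torsion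
    by (intro exI[of _ "Suc 0"] exI[of _ "\<lambda>_. coord 0"])
      (auto simp: conf_dual.span_base dest: zero)
qed

lemma conf_dual_torsion_free:
  "p \<noteq> 0 \<Longrightarrow> conf_dual_smul p f = 0 \<Longrightarrow> f = 0"
  by (auto simp: fun_eq_iff conf_dual_smul_apply pcompose_eq_0_iff)

text \<open>The dual is torsion-free, so \<open>B\<close> is spanned by \<open>n\<close>
  functionals. Among combinations of \<open>n + 1\<close> vectors \<open>e_i\<close> a nonzero one
  is killed by all of them; hence the annihilator contains \<open>K\<close>.\<close>

lemma finite_rank_good_subset:
  assumes good: "g.cur.good B" and fin: "conf_dual.finite_rank B"
  shows "B \<subseteq> conf_dual.span {coord 0}"
proof -
  have conf: "f \<in> cur.conf_dual" if "f \<in> B" for f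
    by (rule subsetD[OF g.cur.goodD(2)[OF good] that])
  have lin: "clinear f" if "f \<in> B" for f using conf[OF that] by (simp add: cur.conf_dual_def)
  have pure: "f (q \<otimes> v) = q * f (1 \<otimes> v)" if "f \<in> B" for f q v
    using cur.conf_dual_smul_right[OF conf[OF that], of q "1 \<otimes> v"] by simp
  let ?I = "{x. \<forall>f\<in>B. f x = 0}"
  have torsion: "t = 0" if "t \<in> conf_dual.torsion_mod B {0}" for t
    using that conf_dual_torsion_free[of _ t] by (auto simp: conf_dual.torsion_mod_def)
  obtain n and a :: "nat \<Rightarrow> g_space cur \<Rightarrow> complex poly" where a: "\<forall>i<n. a i \<in> B"
    and eq: "B = {(\<Sum>i<n. conf_dual_smul (p i) (a i)) + t | p t. t \<in> conf_dual.torsion_mod B {0}}"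
    using fin unfolding conf_dual.finite_rank_mod_def by blast
  have B: "\<exists>p. f = (\<Sum>i<n. conf_dual_smul (p i) (a i))" if mem: "f \<in> B" for f
  proof -
    obtain p t where f: "f = (\<Sum>i<n. conf_dual_smul (p i) (a i)) + t"
      and t: "t \<in> conf_dual.torsion_mod B {0}"
      using subsetD[OF equalityD1[OF eq] mem] by (elim CollectE exE conjE)
    have "f = (\<Sum>i<n. conf_dual_smul (p i) (a i))"
      unfolding f torsion[OF t] by (rule add_0_right)
    then show ?thesis by (rule exI[of _ p])
  qed
  have zero: "x \<in> ?I" if "coord 0 x = 0" for x
  proof (rule ideal_contains_span[OF g.cur.ideal_annihilator[OF good] _ that])
    fix N
    let ?A = "{N..N + n}"
    obtain q where q: "\<exists>i\<in>?A. q i \<noteq> 0" "\<forall>j<n. (\<Sum>i\<in>?A. q i * a j (1 \<otimes> basis_e i)) = 0"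
      using nontrivial_linear_relation[of ?A n "\<lambda>i j. a j (1 \<otimes> basis_e i)"] by auto
    let ?x = "\<Sum>i\<in>?A. q i \<otimes> basis_e i"
    have "f ?x = (\<Sum>i\<in>?A. q i * f (1 \<otimes> basis_e i))" if "f \<in> B" for f
      unfolding clinear_sum[OF lin[OF that]] by (rule sum.cong[OF refl], rule pure[OF that])
    then have ax: "a j ?x = 0" if "j < n" for j using a q(2) that by simp
    have "f ?x = 0" if f: "f \<in> B" for f
    proof -
      obtain p where "f = (\<Sum>i<n. conf_dual_smul (p i) (a i))" using B[OF f] by blast
      then have "f ?x = (\<Sum>i<n. conf_dual_smul (p i) (a i) ?x)"
        by (simp only: clinear_sum[OF clinear_apply])
      also have "\<dots> = 0" by (simp only: conf_dual_smul_apply) (simp add: ax)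
      finally show ?thesis .
    qed
    then show "\<exists>A q. finite A \<and> A \<subseteq> {N..} \<and> (\<exists>i\<in>A. q i \<noteq> 0) \<and>
        (\<Sum>i\<in>A. q i \<otimes> basis_e i) \<in> ?I"
      using q(1) by (intro exI[of _ ?A] exI[of _ q]) auto
  qed
  show ?thesis
  proof
    fix f assume f: "f \<in> B"
    define p where "p = f (1 \<otimes> basis_e 0)"
    \<comment> \<open>The action substitutes -\<lambda>, so \<open>p\<close> is composed with
      -\<lambda> beforehand to cancel it.\<close>
    have "f = conf_dual_smul (pcompose p [:0, -1:]) (coord 0)"
    proof
      fix x
      have "f (x - coord 0 x \<otimes> basis_e 0) = 0"
        using zero[of "x - coord 0 x \<otimes> basis_e 0"] f
        by (simp add: clinear_diff[OF clinear_coord] e_star_basis)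
      then have "f x = coord 0 x * p"
        unfolding p_def clinear_diff[OF lin[OF f]] pure[OF f, of "coord 0 x" "basis_e 0"] by simp
      then show "f x = conf_dual_smul (pcompose p [:0, -1:]) (coord 0) x"
        by (simp add: conf_dual_smul_apply pcompose_pCons mult.commute flip: pcompose_assoc)
    qed
    then show "f \<in> conf_dual.span {coord 0}" by (simp add: conf_dual.span_singleton)
  qed
qed

text \<open>The span of \<open>coord 0\<close> is itself good of finite rank and contains all
  others, so the union is already this submodule.\<close>

lemma Loc_L0_eq_span: "g.cur.Loc_L0 = conf_dual.span {coord 0}"
proof -
  let ?S = "\<Union> {B. g.cur.good B \<and> conf_dual.finite_rank B}"
  have "?S = conf_dual.span {coord 0}"
    using finite_rank_good_subset good_coord_0 finite_rank_coord_0 by blast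
  then show ?thesis
    by (simp only: g.cur.Loc_L0_eq conf_dual.span_span)
qed

lemma theta_Cur_subset_L0: "theta ` Cur (cv.span (range e_star)) \<subseteq> g.cur.L0"
proof -
  let ?V = "conf_dual.span (range coord)"
  have V: "cv.subspace ?V" by (intro conf_dual.cv_subspace conf_dual.subspace_span)
  have "theta (q \<otimes> \<phi>) \<in> ?V" if "\<phi> \<in> cv.span (range e_star)" for q \<phi>
    using that
  proof (induction rule: cv.span_induct_alt)
    case base
    show ?case
      unfolding pure_tensor_simps clinear_0[OF clinear_theta] by (rule conf_dual.span_zero)
  next
    case (step c \<phi> \<psi>)
    then obtain i where "\<phi> = e_star i" by blast
    then have "theta (q \<otimes> \<phi>) \<in> ?V"
      by (simp add: theta_pure_e_star conf_dual.span_scale conf_dual.span_base)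
    then show ?case
      unfolding pure_tensor_simps clinear_add[OF clinear_theta] clinear_scale[OF clinear_theta]
      by (intro cv.subspace_add cv.subspace_scale V step(2))
  qed
  then have "theta t \<in> ?V" if "t \<in> Cur (cv.span (range e_star))" for t
    by (rule clinear_image_tensor_sub[OF clinear_theta _ V that[unfolded Cur_def]])
  then show ?thesis
    by (intro image_subsetI subsetD[OF g.cur.good_subset_L0[OF good_coords]])
qed

section \<open>The classical coproduct on functionals of the Lie algebra\<close>

lemma e_star_coproduct:
  "g.coproduct_of (e_star i)
     (if i = 0 then 0 else e_star 0 \<otimes> e_star (i + 1) - e_star (i + 1) \<otimes> e_star 0)"
proof -
  note bil = cbilinear_mult[OF clinear_apply clinear_apply]
  show ?thesis
    by (simp add: g.coproduct_of_def e_star_g_bracket clinear_diff[OF tensor_lift_clinear[OF bil]]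
        clinear_0[OF tensor_lift_clinear[OF bil]] tensor_lift_pure[OF bil])
qed

context complex_lie_algebra
begin

text \<open>Evaluations at vectors separate functionals, hence also their tensors.\<close>

lemma coproduct_of_unique:
  assumes "coproduct_of \<phi> t" "coproduct_of \<phi> s"
  shows "t = s"
proof -
  note bil = cbilinear_mult[OF clinear_apply clinear_apply]
  have "t - s = 0"
  proof (rule tensor_separated[where S = "range (\<lambda>x \<phi>. \<phi> x)" and T = "range (\<lambda>x \<phi>. \<phi> x)"])
    show "tensor_lift (\<lambda>\<phi> \<psi>. f \<phi> * h \<psi>) (t - s) = 0"
      if fh: "f \<in> range (\<lambda>x \<phi>. \<phi> x)" "h \<in> range (\<lambda>x \<phi>. \<phi> x)" for f h
    proof -
      obtain x y where "f = (\<lambda>\<phi>. \<phi> x)" "h = (\<lambda>\<phi>. \<phi> y)" using fh by blast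
      then show ?thesis
        using assms by (simp add: coproduct_of_def clinear_diff[OF tensor_lift_clinear[OF bil]])
    qed
  next
    show "\<phi> = 0" if "\<And>f. f \<in> range (\<lambda>x \<phi>. \<phi> x) \<Longrightarrow> f \<phi> = 0" for \<phi> :: "'a \<Rightarrow> complex"
      using that[OF rangeI] by (simp add: fun_eq_iff)
    then show "\<phi> = 0" if "\<And>f. f \<in> range (\<lambda>x \<phi>. \<phi> x) \<Longrightarrow> f \<phi> = 0" for \<phi> :: "'a \<Rightarrow> complex"
      using that by blast
  qed (auto simp: clinear_apply)
  then show ?thesis by simp
qed

lemma coproduct_eqI: "t \<in> tensor_sub V V \<Longrightarrow> coproduct_of \<phi> t \<Longrightarrow> coproduct V \<phi> = t"
  unfolding coproduct_def by (rule the_equality) (auto intro: coproduct_of_unique)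

text \<open>The combined form \<open>c *\<^sub>C \<phi> + \<psi>\<close> is the one met in induction
  over a span.\<close>

lemma coproduct_of_linear:
  assumes "coproduct_of \<phi> t" "coproduct_of \<psi> s"
  shows "coproduct_of (c *\<^sub>C \<phi> + \<psi>) (c *\<^sub>C t + s)"
proof -
  note lin = tensor_lift_clinear[OF cbilinear_mult[OF clinear_apply clinear_apply]]
  show ?thesis
    using assms
    by (simp add: coproduct_of_def clinear_add[OF lin] clinear_scale[OF lin] scaleC_fun_def)
qed

end

lemma
  fixes V :: "(g_space \<Rightarrow> complex) set"
  defines "V \<equiv> cv.span (range e_star)"
  shows good_subspace_e_star: "g.good_subspace V"
    and coproduct_e_star: "g.coproduct V (e_star i)
      = (if i = 0 then 0 else e_star 0 \<otimes> e_star (i + 1) - e_star (i + 1) \<otimes> e_star 0)"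
proof -
  have V: "e_star i \<in> V" for i by (simp add: V_def cv.span_base)
  let ?t = "\<lambda>i. if i = 0 then 0 else e_star 0 \<otimes> e_star (i + 1) - e_star (i + 1) \<otimes> e_star 0"
  have t: "?t i \<in> tensor_sub V V" for i
    by (simp add: cv.subspace_diff[OF tensor_sub_subspace] cv.subspace_0[OF tensor_sub_subspace]
        pure_in_tensor_sub V)
  show "g.coproduct V (e_star i) = ?t i"
    by (rule g.coproduct_eqI[OF t e_star_coproduct])
  have "clinear \<phi> \<and> (\<exists>t\<in>tensor_sub V V. g.coproduct_of \<phi> t)" if "\<phi> \<in> V" for \<phi>
    using that unfolding V_def
  proof (induction rule: cv.span_induct_alt)
    case base
    \<comment> \<open>The zero functional is obtained as
      \<open>-1 *\<^sub>C e_star 0 + e_star 0\<close>.\<close>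
    have "g.coproduct_of 0 0"
      using g.coproduct_of_linear[OF e_star_coproduct e_star_coproduct, of "-1" 0 0] by simp
    then show ?case
      using clinear_zero cv.subspace_0[OF tensor_sub_subspace] by (force simp: zero_fun_def)
  next
    case (step c \<phi> \<psi>)
    then obtain i s where i: "\<phi> = e_star i" and s: "s \<in> tensor_sub V V" "g.coproduct_of \<psi> s"
      and lin: "clinear \<psi>"
      by (auto simp: V_def)
    have "clinear (c *\<^sub>C \<phi> + \<psi>)"
      using clinear_plus[OF clinear_mult[OF clinear_e_star] lin, of c i]
      by (simp add: i plus_fun_def scaleC_fun_def)
    moreover have "c *\<^sub>C ?t i + s \<in> tensor_sub V V"
      by (intro cv.subspace_add cv.subspace_scale tensor_sub_subspace t s)
    moreover have "g.coproduct_of (c *\<^sub>C \<phi> + \<psi>) (c *\<^sub>C ?t i + s)"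
      unfolding i by (rule g.coproduct_of_linear[OF e_star_coproduct s(2)])
    ultimately show ?case unfolding V_def by blast
  qed
  then show "g.good_subspace V"
    unfolding g.good_subspace_def by (auto simp: V_def cv.subspace_span)
qed

theorem proposition5p2:
  shows "((\<forall>a. \<not> (\<exists>c. c \<noteq> 0 \<and> a = [:c:]) \<longrightarrow> g.cur.ideal (J a)) \<and>
      {I. g.cur.ideal I \<and> g.cur.cofinite_rank I \<and> I \<noteq> {0} \<and> I \<noteq> UNIV}
        = {J a | a. \<not> (\<exists>c. c \<noteq> 0 \<and> a = [:c:])}) \<and>
    ({0} \<noteq> conf_dual.span {theta (1 \<otimes> e_star 0)} \<and>
      conf_dual.span {theta (1 \<otimes> e_star 0)} = g.cur.Loc_L0) \<and>
    (g.good_subspace (cv.span (range e_star)) \<and>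
      g.coproduct (cv.span (range e_star)) (e_star 0) = 0 \<and>
      (\<forall>i\<ge>1. g.coproduct (cv.span (range e_star)) (e_star i)
        = e_star 0 \<otimes> e_star (i + 1) - e_star (i + 1) \<otimes> e_star 0)) \<and>
    theta ` Cur (cv.span (range e_star)) \<subseteq> g.cur.L0 \<and>
    ({0} \<noteq> g.cur.Loc_L0 \<and> g.cur.Loc_L0 \<subset> g.cur.L0)"
proof -
  let ?E = "conf_dual.span {coord 0}"
  have nonzero: "{0} \<noteq> ?E"
  proof
    assume "{0} = ?E"
    then have "coord 0 = 0" using conf_dual.span_base[of "coord 0" "{coord 0}"] by (metis singletonD singletonI)
    then have "coord 0 (1 \<otimes> basis_e 0) = 0" by simp
    then show False by (simp add: e_star_basis)
  qed
  \<comment> \<open>Every multiple of \<open>coord 0\<close> vanishes at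
    \<open>1 \<otimes> e_1\<close>, where \<open>coord 1\<close> is 1; this makes the inclusion
    strict.\<close>
  have "coord 1 \<notin> ?E"
  proof
    assume "coord 1 \<in> ?E"
    then obtain p where "coord 1 = conf_dual_smul p (coord 0)"
      by (auto simp: conf_dual.span_singleton)
    then have "coord 1 (1 \<otimes> basis_e 1) = conf_dual_smul p (coord 0) (1 \<otimes> basis_e 1)" by simp
    then show False by (simp add: conf_dual_smul_apply e_star_basis)
  qed
  moreover have "coord 1 \<in> g.cur.L0"
    by (intro subsetD[OF g.cur.good_subset_L0[OF good_coords]] conf_dual.span_base rangeI)
  moreover have "?E \<subseteq> g.cur.L0" by (rule g.cur.good_subset_L0[OF good_coord_0])
  ultimately have "?E \<subset> g.cur.L0" by blast
  then show ?thesis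
    unfolding coord_def[symmetric] Loc_L0_eq_span coproduct_e_star
    using nonzero by (intro conjI allI impI J_ideal nontrivial_cofinite_ideals
        theta_Cur_subset_L0 good_subspace_e_star) simp_all
qed

end
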